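(* Let $\{\pi_k\}_{k\ge0}$ be the policy sequence generated by PMD with mirror map $h(p)=\sum_a\psi(p(a))$ and a constant step size $\eta>0$. If $\psi'(0^+)>-\infty$, $\psi'(1^-)=+\infty$, and the optimal action is non-unique for all states (i.e. $\mathcal S_{>1}=\mathcal S$), then there exists a finite time $T_{\mathrm{ter}}$ such that $$\forall\,t\ge T_{\mathrm{ter}}:\quad\pi_t=\pi_{T_{\mathrm{ter}}}\in\Pi^*.$$
   Context: MDP: $(\mathcal S,\mathcal A,P,r,\gamma)$ is a finite discounted Markov decision process: finite state space $\mathcal S$, finite action space $\mathcal A$, transition model $P(\cdot|s,a)\in\Delta(\mathcal S)$, reward $r:\mathcal S\times\mathcal A\to[0,1]$, discount $\gamma\in[0,1)$. $\Delta(\mathcal X)$ is the probability simplex over a finite set $\mathcal X$. A policy $\pi$ assigns to each $s$ a distribution $\pi(\cdot|s)\in\Delta(\mathcal A)$; $\Pi$ is the set of all policies. $V^\pi(s)$ is the expected value of $\sum_{t\ge0}\gamma^t r(s_t,a_t)$ given $s_0=s$, $a_t\sim\pi(\cdot|s_t)$, $s_{t+1}\sim P(\cdot|s_t,a_t)$, and $Q^\pi(s,a)$ is the same conditioned on $(s_0,a_0)=(s,a)$. $V^*(s)=\max_{\pi\in\Pi}V^\pi(s)$, $Q^*(s,a)=\max_{\pi\in\Pi}Q^\pi(s,a)$; $\Pi^*$ is the set of optimal policies ($V^\pi=V^*$). $\mathcal A^*_s=\{a: Q^*(s,a)=V^*(s)\}$, $\mathcal S_{>1}=\{s:|\mathcal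 A_s^*|>1\}$, $\tilde{\mathcal S}=\{s:\mathcal A_s^*\ne\mathcal A\}$, the last assumed nonempty throughout. Mirror map: $\psi:\mathbb R\to(-\infty,+\infty]$ satisfies: (a) $\mathrm{dom}\,\psi\supseteq[0,1]$; (b) $\psi$ is proper, closed and convex; (c) $\psi$ is differentiable on $\mathrm{int}\,\mathrm{dom}\,\psi$ and $|\psi'(x_n)|\to\infty$ for every sequence $\{x_n\}\subseteq\mathrm{int}\,\mathrm{dom}\,\psi$ converging to a boundary point of $\mathrm{dom}\,\psi$; (d) $\psi$ is strictly convex on $\mathrm{int}\,\mathrm{dom}\,\psi$. $\psi'(0^+)$ and $\psi'(1^-)$ are the one-sided limits of $\psi'$ at $0$ from the right and at $1$ from the left. $h(p)=\sum_{a\in\mathcal A}\psi(p(a))$ and $D_h(p\|q)=h(p)-h(q)-\langle\nabla h(q),p-q\rangle$. PMD: given $\eta>0$ and an initial policy $\pi_0$ with $\pi_0(a|s)\in\mathrm{int}\,\mathrm{dom}\,\psi$ for all $(s,a)$ (assumed throughout), for each $s$, $\pi_{k+1}(\cdot|s)=\arg\max_{p\in\Delta(\mathcal A)}\{\eta\langle p,Q^{\pi_k}(s,\cdot)\rangle-D_h(p\|\pi_k(\cdot|s))\}$; all iterates satisfy $\pi_k(a|s)\in\mathrm{int}\,\mathrm{dom}\,\psi$. *)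

theory Defs
  imports "HOL-Probability.Probability"
begin

text \<open>
  Throughout, the state space and the action space are finite types \<open>'s\<close> and \<open>'a\<close>, and the
  probability simplex over a finite set is the corresponding type of probability mass functions.
  A transition model is \<open>P :: 's \<Rightarrow> 'a \<Rightarrow> 's pmf\<close>, a policy is \<open>\<pi> :: 's \<Rightarrow> 'a pmf\<close>, and the set of
  all policies is the whole type.
\<close>

section \<open>Finite discounted Markov decision processes\<close>

type_synonym ('s, 'a) policy = "'s \<Rightarrow> 'a pmf"

definition step_pmf :: "('s \<Rightarrow> 'a \<Rightarrow> 's pmf) \<Rightarrow> ('s, 'a) policy \<Rightarrow> 's \<times> 'a \<Rightarrow> ('s \<times> 'a) pmf"
  where "step_pmf P \<pi> x = bind_pmf (P (fst x) (snd x)) (\<lambda>s'. map_pmf (Pair s') (\<pi> s'))"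

definition traj_kernel ::
    "('s \<Rightarrow> 'a \<Rightarrow> 's pmf) \<Rightarrow> ('s, 'a) policy \<Rightarrow> ('s \<times> 'a) pmf \<Rightarrow> nat \<Rightarrow> (nat \<Rightarrow> 's \<times> 'a) \<Rightarrow> ('s \<times> 'a) measure"
  where "traj_kernel P \<pi> \<mu> n \<omega> =
    (case n of 0 \<Rightarrow> measure_pmf \<mu> | Suc m \<Rightarrow> measure_pmf (step_pmf P \<pi> (\<omega> m)))"

text \<open>
  The law of the trajectory \<open>(s\<^sub>0, a\<^sub>0), (s\<^sub>1, a\<^sub>1), \<dots>\<close> with \<open>(s\<^sub>0, a\<^sub>0)\<close> distributed according
  to \<open>\<mu>\<close>: the Ionescu-Tulcea measure of the above kernels (see the locale instance below).
\<close>

definition traj ::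
    "('s \<Rightarrow> 'a \<Rightarrow> 's pmf) \<Rightarrow> ('s, 'a) policy \<Rightarrow> ('s \<times> 'a) pmf \<Rightarrow> (nat \<Rightarrow> 's \<times> 'a) measure"
  where "traj P \<pi> \<mu> =
    projective_family.lim UNIV
      (Ionescu_Tulcea.CI (traj_kernel P \<pi> \<mu>) (\<lambda>_. count_space UNIV)) (\<lambda>_. count_space UNIV)"

lemma Ionescu_Tulcea_traj_kernel:
  fixes P :: "'s::finite \<Rightarrow> 'a::finite \<Rightarrow> 's pmf"
  shows "Ionescu_Tulcea (traj_kernel P \<pi> \<mu>) (\<lambda>_. count_space UNIV)"
proof (rule Ionescu_Tulcea.intro)
  fix i
  show "traj_kernel P \<pi> \<mu> i \<in> measurable (PiM {0..<i} (\<lambda>_. count_space UNIV))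
          (subprob_algebra (count_space UNIV))"
  proof (cases i)
    case 0
    then show ?thesis
      by (auto simp: traj_kernel_def[abs_def] space_subprob_algebra intro!: measurable_const
          prob_space_imp_subprob_space measure_pmf.prob_space_axioms)
  next
    case (Suc m)
    have "(\<lambda>\<omega>. measure_pmf (step_pmf P \<pi> (\<omega> m))) \<in> measurable (PiM {0..<i} (\<lambda>_. count_space UNIV))
          (subprob_algebra (count_space UNIV))"
    proof (rule measurable_compose[where g = "\<lambda>x. measure_pmf (step_pmf P \<pi> x)"])
      show "(\<lambda>\<omega>. \<omega> m) \<in> measurable (PiM {0..<i} (\<lambda>_. count_space UNIV)) (count_space UNIV)"
        using Suc by (intro measurable_component_singleton) auto
    qed (auto simp: space_subprob_algebra
        intro!: prob_space_imp_subprob_space measure_pmf.prob_space_axioms)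
    then show ?thesis
      using Suc by (simp add: traj_kernel_def[abs_def])
  qed
next
  fix i and x :: "nat \<Rightarrow> 's \<times> 'a"
  show "prob_space (traj_kernel P \<pi> \<mu> i x)"
    by (cases i) (simp_all add: traj_kernel_def measure_pmf.prob_space_axioms)
qed

definition disc_return :: "('s \<Rightarrow> 'a \<Rightarrow> real) \<Rightarrow> real \<Rightarrow> (nat \<Rightarrow> 's \<times> 'a) \<Rightarrow> real"
  where "disc_return r \<gamma> \<omega> = (\<Sum>t. \<gamma> ^ t * r (fst (\<omega> t)) (snd (\<omega> t)))"

definition V_val ::
    "('s \<Rightarrow> 'a \<Rightarrow> 's pmf) \<Rightarrow> ('s \<Rightarrow> 'a \<Rightarrow> real) \<Rightarrow> real \<Rightarrow> ('s, 'a) policy \<Rightarrow> 's \<Rightarrow> real"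
  where "V_val P r \<gamma> \<pi> s = (\<integral>\<omega>. disc_return r \<gamma> \<omega> \<partial>traj P \<pi> (map_pmf (Pair s) (\<pi> s)))"

definition Q_val ::
    "('s \<Rightarrow> 'a \<Rightarrow> 's pmf) \<Rightarrow> ('s \<Rightarrow> 'a \<Rightarrow> real) \<Rightarrow> real \<Rightarrow> ('s, 'a) policy \<Rightarrow> 's \<Rightarrow> 'a \<Rightarrow> real"
  where "Q_val P r \<gamma> \<pi> s a = (\<integral>\<omega>. disc_return r \<gamma> \<omega> \<partial>traj P \<pi> (return_pmf (s, a)))"

text \<open>
  The maxima over all policies are written as suprema; the values are bounded when
  \<open>0 \<le> r \<le> 1\<close> and \<open>0 \<le> \<gamma> < 1\<close>.
\<close>

definition V_opt :: "('s \<Rightarrow> 'a \<Rightarrow> 's pmf) \<Rightarrow> ('s \<Rightarrow> 'a \<Rightarrow> real) \<Rightarrow> real \<Rightarrow> 's \<Rightarrow> real"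
  where "V_opt P r \<gamma> s = (SUP \<pi>. V_val P r \<gamma> \<pi> s)"

definition Q_opt :: "('s \<Rightarrow> 'a \<Rightarrow> 's pmf) \<Rightarrow> ('s \<Rightarrow> 'a \<Rightarrow> real) \<Rightarrow> real \<Rightarrow> 's \<Rightarrow> 'a \<Rightarrow> real"
  where "Q_opt P r \<gamma> s a = (SUP \<pi>. Q_val P r \<gamma> \<pi> s a)"

definition optimal_policies ::
    "('s \<Rightarrow> 'a \<Rightarrow> 's pmf) \<Rightarrow> ('s \<Rightarrow> 'a \<Rightarrow> real) \<Rightarrow> real \<Rightarrow> ('s, 'a) policy set"
  where "optimal_policies P r \<gamma> = {\<pi>. V_val P r \<gamma> \<pi> = V_opt P r \<gamma>}"

definition optimal_actions ::
    "('s \<Rightarrow> 'a \<Rightarrow> 's pmf) \<Rightarrow> ('s \<Rightarrow> 'a \<Rightarrow> real) \<Rightarrow> real \<Rightarrow> 's \<Rightarrow> 'a set"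
  where "optimal_actions P r \<gamma> s = {a. Q_opt P r \<gamma> s a = V_opt P r \<gamma> s}"

definition nonunique_states ::
    "('s \<Rightarrow> 'a \<Rightarrow> 's pmf) \<Rightarrow> ('s \<Rightarrow> 'a \<Rightarrow> real) \<Rightarrow> real \<Rightarrow> 's set"
  where "nonunique_states P r \<gamma> = {s. card (optimal_actions P r \<gamma> s) > 1}"

definition nontrivial_states ::
    "('s \<Rightarrow> 'a \<Rightarrow> 's pmf) \<Rightarrow> ('s \<Rightarrow> 'a \<Rightarrow> real) \<Rightarrow> real \<Rightarrow> 's set"
  where "nontrivial_states P r \<gamma> = {s. optimal_actions P r \<gamma> s \<noteq> UNIV}"

section \<open>Mirror maps\<close>

definition eff_dom :: "(real \<Rightarrow> ereal) \<Rightarrow> real set"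
  where "eff_dom \<psi> = {x. \<psi> x < \<infinity>}"

definition epi :: "(real \<Rightarrow> ereal) \<Rightarrow> (real \<times> real) set"
  where "epi \<psi> = {(x, y). \<psi> x \<le> ereal y}"

text \<open>Meaningful on the interior of the effective domain, where \<open>\<psi>\<close> is finite.\<close>

definition psi_deriv :: "(real \<Rightarrow> ereal) \<Rightarrow> real \<Rightarrow> real"
  where "psi_deriv \<psi> = deriv (\<lambda>x. real_of_ereal (\<psi> x))"

definition mirror_psi :: "(real \<Rightarrow> ereal) \<Rightarrow> bool"
  where "mirror_psi \<psi> \<longleftrightarrow>
    {0..1} \<subseteq> eff_dom \<psi> \<and>
    (\<forall>x. \<psi> x \<noteq> -\<infinity>) \<and> eff_dom \<psi> \<noteq> {} \<and>
    closed (epi \<psi>) \<and> convex (epi \<psi>) \<and>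
    (\<lambda>x. real_of_ereal (\<psi> x)) differentiable_on interior (eff_dom \<psi>) \<and>
    (\<forall>X x. (\<forall>n. X n \<in> interior (eff_dom \<psi>)) \<and> x \<in> frontier (eff_dom \<psi>) \<and> X \<longlonglongrightarrow> x
       \<longrightarrow> filterlim (\<lambda>n. \<bar>psi_deriv \<psi> (X n)\<bar>) at_top sequentially) \<and>
    (\<forall>x\<in>interior (eff_dom \<psi>). \<forall>y\<in>interior (eff_dom \<psi>). \<forall>u. x \<noteq> y \<and> 0 < u \<and> u < 1
       \<longrightarrow> \<psi> ((1 - u) * x + u * y) < ereal (1 - u) * \<psi> x + ereal u * \<psi> y)"

text \<open>
  The one-sided limits exist in the extended reals for every mirror map, because \<open>\<psi>'\<close> is
  increasing on \<open>(0, 1)\<close>.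
\<close>

definition psi_deriv_at_0_right :: "(real \<Rightarrow> ereal) \<Rightarrow> ereal"
  where "psi_deriv_at_0_right \<psi> = Lim (at_right 0) (\<lambda>x. ereal (psi_deriv \<psi> x))"

definition psi_deriv_at_1_left :: "(real \<Rightarrow> ereal) \<Rightarrow> ereal"
  where "psi_deriv_at_1_left \<psi> = Lim (at_left 1) (\<lambda>x. ereal (psi_deriv \<psi> x))"

definition mirror_h :: "(real \<Rightarrow> ereal) \<Rightarrow> real ^ 'a \<Rightarrow> ereal"
  where "mirror_h \<psi> p = (\<Sum>a\<in>UNIV. \<psi> (p $ a))"

definition gradient :: "('v::real_inner \<Rightarrow> real) \<Rightarrow> 'v \<Rightarrow> 'v"
  where "gradient f x = (THE D. GDERIV f x :> D)"

text \<open>Used for \<open>q\<close> with all coordinates in the interior of the effective domain of \<open>\<psi>\<close>.\<close>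

definition bregman :: "(real \<Rightarrow> ereal) \<Rightarrow> real ^ 'a \<Rightarrow> real ^ 'a \<Rightarrow> ereal"
  where "bregman \<psi> p q =
    mirror_h \<psi> p - mirror_h \<psi> q
      - ereal (inner (gradient (\<lambda>x. real_of_ereal (mirror_h \<psi> x)) q) (p - q))"

section \<open>Policy mirror descent\<close>

definition prob_vec :: "'a pmf \<Rightarrow> real ^ 'a"
  where "prob_vec p = (\<chi> a. pmf p a)"

definition pmd_objective ::
    "('s \<Rightarrow> 'a::finite \<Rightarrow> 's pmf) \<Rightarrow> ('s \<Rightarrow> 'a \<Rightarrow> real) \<Rightarrow> real \<Rightarrow> (real \<Rightarrow> ereal) \<Rightarrow> real
      \<Rightarrow> ('s, 'a) policy \<Rightarrow> 's \<Rightarrow> 'a pmf \<Rightarrow> ereal"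
  where "pmd_objective P r \<gamma> \<psi> \<eta> \<pi> s p =
    ereal (\<eta> * inner (prob_vec p) (\<chi> a. Q_val P r \<gamma> \<pi> s a)) - bregman \<psi> (prob_vec p) (prob_vec (\<pi> s))"

definition pmd_sequence ::
    "('s \<Rightarrow> 'a::finite \<Rightarrow> 's pmf) \<Rightarrow> ('s \<Rightarrow> 'a \<Rightarrow> real) \<Rightarrow> real \<Rightarrow> (real \<Rightarrow> ereal) \<Rightarrow> real
      \<Rightarrow> (nat \<Rightarrow> ('s, 'a) policy) \<Rightarrow> bool"
  where "pmd_sequence P r \<gamma> \<psi> \<eta> \<pi> \<longleftrightarrow>
    (\<forall>s a. pmf (\<pi> 0 s) a \<in> interior (eff_dom \<psi>)) \<and>
    (\<forall>k s. is_arg_max (pmd_objective P r \<gamma> \<psi> \<eta> (\<pi> k) s) (\<lambda>_. True) (\<pi> (Suc k) s))"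

end

theory Submission
  imports Defs
begin

text \<open>
  The slope conditions at the two ends play opposite roles. Since \<open>\<psi>'(0\<^sup>+)\<close> is finite, \<open>0\<close> lies in
  the interior of the domain of \<open>\<psi>\<close>, so a probability can drop to exactly \<open>0\<close>; since
  \<open>\<psi>'(1\<^sup>-)\<close> is infinite, \<open>1\<close> lies outside it and every probability of every iterate stays
  below \<open>1\<close>. On \<open>[0, 1)\<close> the derivative \<open>\<psi>'\<close> is thus a strictly increasing real function, bounded
  below by \<open>\<psi>'(0)\<close>.

  Fix a state and write \<open>x\<^sub>k\<close> for the \<open>k\<close>-th policy there and \<open>Q\<^sub>k\<close> for its action values. The
  update has a Lagrange multiplier \<open>\<lambda>\<^sub>k\<close> with
  \<open>\<psi>'(x\<^sub>k\<^sub>+\<^sub>1(a)) \<ge> \<psi>'(x\<^sub>k(a)) + \<eta> Q\<^sub>k(a) - \<lambda>\<^sub>k\<close> for all \<open>a\<close>, with equality where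
  \<open>x\<^sub>k\<^sub>+\<^sub>1(a) > 0\<close> (\<open>deriv_step_ge\<close>, \<open>deriv_step_eq\<close>). If \<open>\<lambda>\<^sub>k\<close> exceeded \<open>\<eta> V\<^sup>*\<close>, every positive
  probability would decrease, which is impossible; hence \<open>u\<^sub>k = \<eta> V\<^sup>* - \<lambda>\<^sub>k\<close> is nonnegative.

  For an optimal action \<open>b\<close> the step increases \<open>\<psi>'(x\<^sub>k(b))\<close> by at least \<open>u\<^sub>k\<close> minus \<open>\<eta>\<close> times the
  error \<open>Q\<^sup>*(b) - Q\<^sub>k(b)\<close>, and these errors are summable (\<open>summable_Q_gap\<close>). So if \<open>\<Sum> u\<^sub>k\<close>
  diverged, \<open>\<psi>'(x\<^sub>k(b))\<close> would tend to infinity for every optimal \<open>b\<close>. This is where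
  non-uniqueness enters: of two optimal actions one always has probability at most \<open>1/2\<close>, so
  the two derivatives cannot both become large. Therefore \<open>u\<^sub>k\<close> is summable and tends to \<open>0\<close>, that
  is, \<open>\<lambda>\<^sub>k\<close> tends to \<open>\<eta> V\<^sup>*\<close>. From then on, as long as a suboptimal action has positive
  probability, each step lowers its \<open>\<psi>'\<close> by a fixed amount; as \<open>\<psi>'\<close> is bounded below by \<open>\<psi>'(0)\<close>,
  the action gets probability \<open>0\<close> after finitely many steps and never returns
  (\<open>suboptimal_action_extinct\<close>).

  Summability of the errors follows from the three-point inequality with an optimal policy as
  comparator: it gives
  \<open>V\<^sup>* - V\<^sub>k\<^sub>+\<^sub>1 \<le> \<gamma> P\<^sup>* (V\<^sup>* - V\<^sub>k) + (D\<^sub>k - D\<^sub>k\<^sub>+\<^sub>1) / \<eta>\<close>, where \<open>P\<^sup>*\<close> is the state transition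
  operator of that policy and \<open>D\<^sub>k\<close> its Bregman divergence from the \<open>k\<close>-th policy. Summation
  telescopes the last term and \<open>\<gamma> < 1\<close> absorbs the first (\<open>summable_V_gap\<close>).

  Once all suboptimal actions have disappeared in all states, the policy is optimal, all
  actions in its support are equally good, and a step without strict gain leaves the policy
  unchanged (\<open>no_improvement_imp_fixed\<close>).
\<close>

section \<open>Marginal laws of the trajectory\<close>

fun state_action_law ::
    "('s \<Rightarrow> 'a \<Rightarrow> 's pmf) \<Rightarrow> ('s, 'a) policy \<Rightarrow> ('s \<times> 'a) pmf \<Rightarrow> nat \<Rightarrow> ('s \<times> 'a) pmf"
  where
    "state_action_law P \<pi> \<mu> 0 = \<mu>"
  | "state_action_law P \<pi> \<mu> (Suc t) = bind_pmf (state_action_law P \<pi> \<mu> t) (step_pmf P \<pi>)"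

text \<open>
  The Ionescu-Tulcea construction describes the law of a finite initial segment by iterated
  kernels. Since the kernel at time \<open>t + 1\<close> looks only at the state-action pair at time \<open>t\<close>,
  integrating it out turns an integrand of the last coordinate into one of the previous
  coordinate, so induction over the length works if the integrand is kept arbitrary.
\<close>

lemma distr_traj_coordinate:
  fixes P :: "'s::finite \<Rightarrow> 'a::finite \<Rightarrow> 's pmf"
  shows "(\<lambda>\<omega>. \<omega> t) \<in> measurable (traj P \<pi> \<mu>) (count_space UNIV)"
    and "distr (traj P \<pi> \<mu>) (count_space UNIV) (\<lambda>\<omega>. \<omega> t) = measure_pmf (state_action_law P \<pi> \<mu> t)"
proof -
  let ?M = "\<lambda>_::nat. count_space (UNIV :: ('s \<times> 'a) set)"
  interpret T: Ionescu_Tulcea "traj_kernel P \<pi> \<mu>" ?M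
    by (rule Ionescu_Tulcea_traj_kernel)
  have sets_traj: "sets (traj P \<pi> \<mu>) = sets (PiM UNIV ?M)"
    unfolding traj_def by (rule T.PF.sets_lim)
  show meas: "(\<lambda>\<omega>. \<omega> t) \<in> measurable (traj P \<pi> \<mu>) (count_space UNIV)" for t
    unfolding measurable_cong_sets[OF sets_traj refl] by (rule measurable_component_singleton) simp
  have start: "(\<lambda>_. undefined) \<in> space (PiM {0..<0} ?M)"
    by (simp add: space_PiM)
  have coord: "(\<lambda>\<omega>. F (\<omega> t)) \<in> borel_measurable (PiM {0..<Suc t} ?M)"
    for F :: "'s \<times> 'a \<Rightarrow> ennreal" and t
    using measurable_compose[OF measurable_component_singleton[of t "{0..<Suc t}" ?M], of F borel] by simp
  \<comment> \<open>Integrate out the last coordinate.\<close>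
  have C_step: "(\<integral>\<^sup>+\<omega>. F (\<omega> t) \<partial>T.C 0 (Suc t) (\<lambda>_. undefined)) =
      (\<integral>\<^sup>+\<omega>. (\<integral>\<^sup>+x. F x \<partial>traj_kernel P \<pi> \<mu> t \<omega>) \<partial>T.C 0 t (\<lambda>_. undefined))"
    for F :: "'s \<times> 'a \<Rightarrow> ennreal" and t
  proof -
    have sets_C: "sets (T.C 0 t (\<lambda>_. undefined)) = sets (PiM {0..<t} ?M)"
      using T.sets_C[OF start, of t] by simp
    have "T.eP t \<in> measurable (T.C 0 t (\<lambda>_. undefined)) (subprob_algebra (PiM {0..<Suc t} ?M))"
      unfolding measurable_cong_sets[OF sets_C refl] by (rule T.measurable_eP)
    then have "(\<integral>\<^sup>+\<omega>. F (\<omega> t) \<partial>T.C 0 (Suc t) (\<lambda>_. undefined)) =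
        (\<integral>\<^sup>+\<omega>. (\<integral>\<^sup>+\<omega>'. F (\<omega>' t) \<partial>T.eP t \<omega>) \<partial>T.C 0 t (\<lambda>_. undefined))"
      by (simp add: nn_integral_bind[OF coord])
    also have "\<dots> = (\<integral>\<^sup>+\<omega>. (\<integral>\<^sup>+x. F x \<partial>traj_kernel P \<pi> \<mu> t \<omega>) \<partial>T.C 0 t (\<lambda>_. undefined))"
      using T.space_C[OF start, of t] by (intro nn_integral_cong) (simp add: T.nn_integral_eP coord)
    finally show ?thesis .
  qed
  have kernel: "traj_kernel P \<pi> \<mu> 0 \<omega> = measure_pmf \<mu>"
    "traj_kernel P \<pi> \<mu> (Suc m) \<omega> = measure_pmf (step_pmf P \<pi> (\<omega> m))" for m \<omega>
    by (simp_all add: traj_kernel_def)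
  have C_law: "(\<integral>\<^sup>+\<omega>. F (\<omega> t) \<partial>T.C 0 (Suc t) (\<lambda>_. undefined)) =
      (\<integral>\<^sup>+x. F x \<partial>state_action_law P \<pi> \<mu> t)" for F :: "'s \<times> 'a \<Rightarrow> ennreal"
  proof (induction t arbitrary: F)
    case 0
    have "prob_space (return (PiM {0..<0} ?M) (\<lambda>_. undefined))"
      using start by (rule prob_space_return)
    then show ?case
      unfolding C_step by (simp add: kernel prob_space.emeasure_space_1 del: space_return)
  next
    case (Suc t)
    show ?case
      unfolding C_step[of "Suc t" F] using Suc.IH[of "\<lambda>x. \<integral>\<^sup>+y. F y \<partial>step_pmf P \<pi> x"]
      by (simp add: kernel nn_integral_bind_pmf del: T.C.simps)
  qed
  show "distr (traj P \<pi> \<mu>) (count_space UNIV) (\<lambda>\<omega>. \<omega> t) = measure_pmf (state_action_law P \<pi> \<mu> t)"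
  proof (rule measure_eqI)
    fix A assume "A \<in> sets (distr (traj P \<pi> \<mu>) (count_space UNIV) (\<lambda>\<omega>. \<omega> t))"
    let ?J = "{0..<Suc t}"
    \<comment> \<open>The library fixes the law of a set of coordinates by a long enough initial segment; here
      it is compared with the segment that ends at time \<open>t\<close>.\<close>
    have le: "Suc t \<le> T.up_to ?J"
      using T.up_to_less[of ?J t] by simp
    have restr: "(\<lambda>\<omega>. restrict \<omega> ?J) \<in> measurable (traj P \<pi> \<mu>) (PiM ?J ?M)"
      unfolding measurable_cong_sets[OF sets_traj refl] by (rule measurable_restrict_subset) simp
    have "emeasure (distr (traj P \<pi> \<mu>) (count_space UNIV) (\<lambda>\<omega>. \<omega> t)) A =
        (\<integral>\<^sup>+\<omega>. indicator A (\<omega> t) \<partial>traj P \<pi> \<mu>)"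
      using meas[of t]
      by (subst nn_integral_indicator[symmetric], simp, subst nn_integral_distr) auto
    also have "\<dots> = (\<integral>\<^sup>+\<omega>. indicator A (restrict \<omega> ?J t) \<partial>traj P \<pi> \<mu>)"
      by simp
    also have "\<dots> = (\<integral>\<^sup>+\<omega>. indicator A (\<omega> t) \<partial>distr (traj P \<pi> \<mu>) (PiM ?J ?M) (\<lambda>\<omega>. restrict \<omega> ?J))"
      by (rule nn_integral_distr[OF restr, symmetric]) (simp add: coord del: restrict_apply)
    also have "distr (traj P \<pi> \<mu>) (PiM ?J ?M) (\<lambda>\<omega>. restrict \<omega> ?J) = T.C 0 (Suc t) (\<lambda>_. undefined)"
      using T.distr_lim[of ?J] T.distr_C[OF le start] by (simp add: traj_def T.CI_def del: T.C.simps)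
    also have "(\<integral>\<^sup>+\<omega>. indicator A (\<omega> t) \<partial>T.C 0 (Suc t) (\<lambda>_. undefined)) =
        emeasure (state_action_law P \<pi> \<mu> t) A"
      unfolding C_law by simp
    finally show "emeasure (distr (traj P \<pi> \<mu>) (count_space UNIV) (\<lambda>\<omega>. \<omega> t)) A =
        emeasure (state_action_law P \<pi> \<mu> t) A" .
  qed simp
qed

lemma prob_space_traj:
  fixes P :: "'s::finite \<Rightarrow> 'a::finite \<Rightarrow> 's pmf"
  shows "prob_space (traj P \<pi> \<mu>)"
  by (rule prob_space_distrD[OF distr_traj_coordinate(1)[of 0]])
    (simp add: distr_traj_coordinate(2) measure_pmf.prob_space_axioms)

lemma state_action_law_bind:
  "state_action_law P \<pi> (bind_pmf \<mu> K) t = bind_pmf \<mu> (\<lambda>x. state_action_law P \<pi> (K x) t)"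
  by (induction t) (simp_all add: bind_assoc_pmf)

text \<open>
  Shifting time by one: a step taken at the start instead of at the end. This is what turns the
  series of discounted rewards into the Bellman equation.
\<close>

lemma state_action_law_Suc:
  "state_action_law P \<pi> \<mu> (Suc t) = state_action_law P \<pi> (bind_pmf \<mu> (step_pmf P \<pi>)) t"
  by (induction t) simp_all

lemma expectation_bind_finite:
  fixes p :: "'x::finite pmf" and f :: "'x \<Rightarrow> 'y::finite pmf" and h :: "'y \<Rightarrow> real"
  shows "measure_pmf.expectation (bind_pmf p f) h =
    (\<Sum>x\<in>UNIV. pmf p x * measure_pmf.expectation (f x) h)"
  by (subst pmf_expectation_bind[of UNIV]) auto

section \<open>Bellman equations and optimal policies\<close>

lemma sum_pmf_UNIV: "(\<Sum>x\<in>UNIV. pmf (p :: 'x::finite pmf) x) = 1"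
  by (rule sum_pmf_eq_1) auto

lemma average_le:
  assumes "\<And>x. h x \<le> c" shows "(\<Sum>x\<in>UNIV. pmf (p :: 'x::finite pmf) x * h x) \<le> c"
proof -
  have "(\<Sum>x\<in>UNIV. pmf p x * h x) \<le> (\<Sum>x\<in>UNIV. pmf p x * c)"
    by (intro sum_mono mult_left_mono assms) simp
  then show ?thesis by (simp add: sum_distrib_right[symmetric] sum_pmf_UNIV)
qed

locale discounted_mdp =
  fixes P :: "'s::finite \<Rightarrow> 'a::finite \<Rightarrow> 's pmf"
    and r :: "'s \<Rightarrow> 'a \<Rightarrow> real"
    and \<gamma> :: real
  assumes reward: "0 \<le> r s a" "r s a \<le> 1"
    and discount: "0 \<le> \<gamma>" "\<gamma> < 1"
begin

definition start_value :: "('s, 'a) policy \<Rightarrow> ('s \<times> 'a) pmf \<Rightarrow> real"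
  where "start_value \<pi> \<mu> =
    (\<Sum>t. \<gamma> ^ t * measure_pmf.expectation (state_action_law P \<pi> \<mu> t) (\<lambda>x. r (fst x) (snd x)))"

lemma expected_reward_bounds:
  "0 \<le> measure_pmf.expectation \<mu> (\<lambda>x. r (fst x) (snd x))"
  "measure_pmf.expectation \<mu> (\<lambda>x. r (fst x) (snd x)) \<le> 1"
  using reward by (auto intro!: integral_nonneg_AE measure_pmf.integral_le_const integrable_measure_pmf_finite)

lemma summable_start_value:
  "summable (\<lambda>t. \<gamma> ^ t * measure_pmf.expectation (state_action_law P \<pi> \<mu> t) (\<lambda>x. r (fst x) (snd x)))"
proof (rule summable_comparison_test')
  show "summable (\<lambda>t. \<gamma> ^ t)" using discount by (simp add: summable_geometric)
  fix t
  show "norm (\<gamma> ^ t * measure_pmf.expectation (state_action_law P \<pi> \<mu> t) (\<lambda>x. r (fst x) (snd x))) \<le> \<gamma> ^ t"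
    using expected_reward_bounds[of "state_action_law P \<pi> \<mu> t"] discount
    by (simp add: abs_mult mult_left_le)
qed

lemma integral_disc_return:
  "(\<integral>\<omega>. disc_return r \<gamma> \<omega> \<partial>traj P \<pi> \<mu>) = start_value \<pi> \<mu>"
proof -
  interpret prob_space "traj P \<pi> \<mu>" by (rule prob_space_traj)
  let ?R = "\<lambda>t \<omega>. \<gamma> ^ t * r (fst (\<omega> t)) (snd (\<omega> t))"
  have meas: "?R t \<in> borel_measurable (traj P \<pi> \<mu>)" for t
    by (rule measurable_compose[OF distr_traj_coordinate(1), where g = "\<lambda>x. \<gamma> ^ t * r (fst x) (snd x)"]) simp
  have bound: "norm (?R t \<omega>) \<le> \<gamma> ^ t" for t \<omega>
    using reward discount by (simp add: abs_mult mult_left_le)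
  have integrable: "integrable (traj P \<pi> \<mu>) (?R t)" for t
    using bound meas by (intro integrable_const_bound[where B = "\<gamma> ^ t"]) auto
  have geo: "summable (\<lambda>t. \<gamma> ^ t)" using discount by (simp add: summable_geometric)
  have "(\<integral>\<omega>. disc_return r \<gamma> \<omega> \<partial>traj P \<pi> \<mu>) = (\<Sum>t. \<integral>\<omega>. ?R t \<omega> \<partial>traj P \<pi> \<mu>)"
    unfolding disc_return_def
  proof (rule integral_suminf[OF integrable])
    show "AE \<omega> in traj P \<pi> \<mu>. summable (\<lambda>t. norm (?R t \<omega>))"
      by (rule AE_I2, rule summable_comparison_test'[OF geo]) (use bound in simp)
    have "(\<integral>\<omega>. norm (?R t \<omega>) \<partial>traj P \<pi> \<mu>) \<le> \<gamma> ^ t" for t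
      using bound[of t] integrable by (intro integral_le_const) auto
    then show "summable (\<lambda>t. \<integral>\<omega>. norm (?R t \<omega>) \<partial>traj P \<pi> \<mu>)"
      by (intro summable_comparison_test'[OF geo]) (simp add: integral_nonneg_AE)
  qed
  also have "(\<lambda>t. \<integral>\<omega>. ?R t \<omega> \<partial>traj P \<pi> \<mu>) =
      (\<lambda>t. \<gamma> ^ t * measure_pmf.expectation (state_action_law P \<pi> \<mu> t) (\<lambda>x. r (fst x) (snd x)))"
    using integral_distr[OF distr_traj_coordinate(1)[of _ P \<pi> \<mu>], of "\<lambda>x. r (fst x) (snd x)"]
    by (simp add: distr_traj_coordinate(2))
  finally show ?thesis unfolding start_value_def .
qed

text \<open>
  The value is affine in the starting distribution, because each marginal law is.
\<close>

lemma start_value_bind: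
  fixes \<nu> :: "'x::finite pmf"
  shows "start_value \<pi> (bind_pmf \<nu> K) = (\<Sum>x\<in>UNIV. pmf \<nu> x * start_value \<pi> (K x))"
proof -
  have "start_value \<pi> (bind_pmf \<nu> K) = (\<Sum>t. \<Sum>x\<in>UNIV. pmf \<nu> x * (\<gamma> ^ t *
      measure_pmf.expectation (state_action_law P \<pi> (K x) t) (\<lambda>x. r (fst x) (snd x))))"
    unfolding start_value_def state_action_law_bind expectation_bind_finite
    by (simp add: sum_distrib_left mult_ac)
  also have "\<dots> = (\<Sum>x\<in>UNIV. \<Sum>t. pmf \<nu> x * (\<gamma> ^ t *
      measure_pmf.expectation (state_action_law P \<pi> (K x) t) (\<lambda>x. r (fst x) (snd x))))"
    by (rule suminf_sum) (intro summable_mult summable_start_value)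
  also have "\<dots> = (\<Sum>x\<in>UNIV. pmf \<nu> x * start_value \<pi> (K x))"
    unfolding start_value_def by (simp add: suminf_mult summable_start_value)
  finally show ?thesis .
qed

lemma start_value_return:
  "start_value \<pi> (return_pmf x) = r (fst x) (snd x) + \<gamma> * start_value \<pi> (step_pmf P \<pi> x)"
proof -
  have "start_value \<pi> (return_pmf x) = r (fst x) (snd x) + (\<Sum>t. \<gamma> ^ Suc t *
      measure_pmf.expectation (state_action_law P \<pi> (return_pmf x) (Suc t)) (\<lambda>x. r (fst x) (snd x)))"
    unfolding start_value_def
    by (subst suminf_split_head[OF summable_start_value]) simp
  then show ?thesis
    unfolding state_action_law_Suc bind_return_pmf start_value_def
    by (simp add: mult.assoc suminf_mult summable_start_value)
qed

abbreviation V where "V \<equiv> V_val P r \<gamma>"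
abbreviation Q where "Q \<equiv> Q_val P r \<gamma>"

definition lookahead :: "('s \<Rightarrow> real) \<Rightarrow> 's \<Rightarrow> 'a \<Rightarrow> real"
  where "lookahead U s a = r s a + \<gamma> * (\<Sum>s'\<in>UNIV. pmf (P s a) s' * U s')"

lemma V_eq_average_Q: "V \<pi> s = (\<Sum>a\<in>UNIV. pmf (\<pi> s) a * Q \<pi> s a)"
  by (simp add: V_val_def Q_val_def integral_disc_return map_pmf_def start_value_bind)

lemma Q_eq_lookahead_V: "Q \<pi> s a = lookahead (V \<pi>) s a"
proof -
  have "step_pmf P \<pi> (s, a) = bind_pmf (P s a) (\<lambda>s'. map_pmf (Pair s') (\<pi> s'))"
    by (simp add: step_pmf_def)
  then show ?thesis
    by (simp add: lookahead_def V_val_def Q_val_def integral_disc_return start_value_return start_value_bind)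
qed

lemma lookahead_mono: "(\<And>s. U s \<le> W s) \<Longrightarrow> lookahead U s a \<le> lookahead W s a"
  unfolding lookahead_def using discount
  by (intro add_left_mono mult_left_mono sum_mono) auto

lemma lookahead_diff:
  "lookahead U s a - lookahead W s a = \<gamma> * (\<Sum>s'\<in>UNIV. pmf (P s a) s' * (U s' - W s'))"
  by (simp add: lookahead_def right_diff_distrib sum_subtractf)

lemma lookahead_diff_le: "(\<And>s. U s - W s \<le> c) \<Longrightarrow> lookahead U s a - lookahead W s a \<le> \<gamma> * c"
  unfolding lookahead_diff using discount by (intro mult_left_mono average_le)

text \<open>
  A sub-solution of the Bellman equation of a policy lies below every super-solution: the largest
  difference \<open>m\<close> satisfies \<open>m \<le> \<gamma> * m\<close>. Both policy improvement and optimality of greedy policies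
  are instances.
\<close>

lemma bellman_comparison:
  assumes U: "\<And>s. U s \<le> (\<Sum>a\<in>UNIV. pmf (\<pi> s) a * lookahead U s a)"
    and W: "\<And>s. (\<Sum>a\<in>UNIV. pmf (\<pi> s) a * lookahead W s a) \<le> W s"
  shows "U s \<le> W s"
proof -
  define m where "m = Max (range (\<lambda>s. U s - W s))"
  have m: "U s - W s \<le> m" for s by (simp add: m_def)
  have "U s - W s \<le> \<gamma> * m" for s
  proof -
    have "U s - W s \<le> (\<Sum>a\<in>UNIV. pmf (\<pi> s) a * (lookahead U s a - lookahead W s a))"
      using U[of s] W[of s] by (simp add: right_diff_distrib sum_subtractf)
    also have "\<dots> \<le> \<gamma> * m" by (intro average_le lookahead_diff_le m)
    finally show ?thesis .
  qed
  then have "m \<le> \<gamma> * m" unfolding m_def by (subst Max_le_iff) auto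
  then have "(1 - \<gamma>) * m \<le> 0" by (simp add: algebra_simps)
  then have "m \<le> 0" using discount by (simp add: mult_le_0_iff)
  with m[of s] show ?thesis by simp
qed

lemma V_fixed_point: "(\<Sum>a\<in>UNIV. pmf (\<pi> s) a * lookahead (V \<pi>) s a) = V \<pi> s"
  by (simp add: V_eq_average_Q[of \<pi> s] Q_eq_lookahead_V)

lemma V_ge: "(\<And>s. U s \<le> (\<Sum>a\<in>UNIV. pmf (\<pi> s) a * lookahead U s a)) \<Longrightarrow> U s \<le> V \<pi> s"
  by (rule bellman_comparison[where \<pi> = \<pi>]) (simp_all add: V_fixed_point)

lemma V_le: "(\<And>s. (\<Sum>a\<in>UNIV. pmf (\<pi> s) a * lookahead U s a) \<le> U s) \<Longrightarrow> V \<pi> s \<le> U s"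
  by (rule bellman_comparison[where \<pi> = \<pi>]) (simp_all add: V_fixed_point)

text \<open>
  Among the finitely many deterministic policies take one with the largest total value. If some
  action were better in some state, switching to it there would raise the total value.
\<close>

lemma greedy_policy_exists: "\<exists>\<pi>. \<forall>s a. Q \<pi> s a \<le> V \<pi> s"
proof -
  define det where "det d = (\<lambda>s. return_pmf (d s))" for d :: "'s \<Rightarrow> 'a"
  have avg_det: "(\<Sum>a\<in>UNIV. pmf (det d s) a * h a) = h (d s)" for d s and h :: "'a \<Rightarrow> real"
    using integral_measure_pmf[of UNIV "det d s" h] by (simp add: det_def)
  have V_det: "V (det d) s = Q (det d) s (d s)" for d s
    by (simp add: V_eq_average_Q avg_det)
  define total where "total d = (\<Sum>s\<in>UNIV. V (det d) s)" for d
  obtain d where d: "total d' \<le> total d" for d'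
  proof -
    have "Max (range total) \<in> range total" by (intro Max_in) auto
    then obtain d where "total d = Max (range total)" by force
    then show thesis by (intro that[of d]) simp
  qed
  have "Q (det d) s a \<le> V (det d) s" for s a
  proof (rule ccontr)
    assume "\<not> Q (det d) s a \<le> V (det d) s"
    then have better: "V (det d) s < Q (det d) s a" by simp
    let ?d' = "d(s := a)"
    have improves: "V (det d) s' \<le> V (det ?d') s'" for s'
    proof (rule V_ge)
      fix s'
      show "V (det d) s' \<le> (\<Sum>a\<in>UNIV. pmf (det ?d' s') a * lookahead (V (det d)) s' a)"
        using better V_det[of d s'] by (cases "s' = s") (simp_all add: avg_det flip: Q_eq_lookahead_V)
    qed
    have "V (det d) s < Q (det d) s a" by (rule better)
    also have "\<dots> \<le> Q (det ?d') s a"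
      unfolding Q_eq_lookahead_V by (rule lookahead_mono) (rule improves)
    also have "\<dots> = V (det ?d') s" by (simp add: V_det)
    finally have "total d < total ?d'"
      unfolding total_def using improves by (intro sum_strict_mono_ex1) auto
    with d[of ?d'] show False by simp
  qed
  then show ?thesis by blast
qed

abbreviation Vs where "Vs \<equiv> V_opt P r \<gamma>"
abbreviation Qs where "Qs \<equiv> Q_opt P r \<gamma>"

text \<open>
  The value of a policy that is greedy for itself is a super-solution of the Bellman equation of
  every other policy. In particular the suprema in the definitions of the optimal values are
  attained, by the same policy for all states and actions.
\<close>

lemma greedy_policy_optimal:
  assumes greedy: "\<And>s a. Q \<pi> s a \<le> V \<pi> s"
  shows "V \<rho> s \<le> V \<pi> s" "V \<pi> = Vs" "Q \<pi> = Qs"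
proof -
  show V_max: "V \<rho> s \<le> V \<pi> s" for \<rho> s
    by (rule V_le) (intro average_le greedy[unfolded Q_eq_lookahead_V])
  have "Vs s = V \<pi> s" for s
    unfolding V_opt_def by (intro cSup_eq_maximum) (auto intro: V_max)
  then show "V \<pi> = Vs" by (simp add: fun_eq_iff)
  have "Q \<rho> s a \<le> Q \<pi> s a" for \<rho> s a
    unfolding Q_eq_lookahead_V by (rule lookahead_mono) (rule V_max)
  then have "Qs s a = Q \<pi> s a" for s a
    unfolding Q_opt_def by (intro cSup_eq_maximum) auto
  then show "Q \<pi> = Qs" by (simp add: fun_eq_iff)
qed

lemma optimal_policy_exists:
  obtains \<pi> where "V \<pi> = Vs" "Q \<pi> = Qs" "\<And>\<rho> s. V \<rho> s \<le> V \<pi> s" "\<And>s a. Q \<pi> s a \<le> V \<pi> s"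
  using greedy_policy_exists greedy_policy_optimal by metis

lemma V_le_opt: "V \<pi> s \<le> Vs s"
  using optimal_policy_exists by metis

lemma Q_opt_le_V_opt: "Qs s a \<le> Vs s"
  using optimal_policy_exists by metis

lemma Q_opt_eq_lookahead: "Qs s a = lookahead Vs s a"
  using optimal_policy_exists Q_eq_lookahead_V by metis

lemma Q_le_opt: "Q \<pi> s a \<le> Qs s a"
  unfolding Q_opt_eq_lookahead Q_eq_lookahead_V by (rule lookahead_mono) (rule V_le_opt)

end

section \<open>One-dimensional mirror maps\<close>

text \<open>
  What the two slope conditions leave of a mirror map. The tangent inequality includes the right
  endpoint \<open>y = 1\<close>, where the function is finite although its derivative blows up; differentiability
  at \<open>0\<close> is two-sided.
\<close>

locale scalar_mirror =
  fixes f g :: "real \<Rightarrow> real"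
  assumes deriv: "0 \<le> x \<Longrightarrow> x < 1 \<Longrightarrow> (f has_real_derivative g x) (at x)"
    and tangent: "0 \<le> x \<Longrightarrow> x < 1 \<Longrightarrow> 0 \<le> y \<Longrightarrow> y \<le> 1 \<Longrightarrow> f x + g x * (y - x) \<le> f y"
    and deriv_strict_mono: "0 \<le> x \<Longrightarrow> x < y \<Longrightarrow> y < 1 \<Longrightarrow> g x < g y"
    and deriv_unbounded: "\<exists>x. 0 < x \<and> x < 1 \<and> B < g x"

context
  fixes \<psi> :: "real \<Rightarrow> ereal"
  assumes mirror: "mirror_psi \<psi>"
begin

private abbreviation f where "f \<equiv> \<lambda>x. real_of_ereal (\<psi> x)"
private abbreviation g where "g \<equiv> psi_deriv \<psi>"
private abbreviation "I \<equiv> interior (eff_dom \<psi>)"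

lemma psi_finite: "x \<in> eff_dom \<psi> \<Longrightarrow> \<psi> x = ereal (f x)"
  using mirror unfolding mirror_psi_def eff_dom_def by (cases "\<psi> x") auto

lemma unit_interval_subset: "{0..1} \<subseteq> eff_dom \<psi>"
  using mirror by (simp add: mirror_psi_def)

lemma open_unit_interval_subset: "{0<..<1} \<subseteq> I"
  using interior_mono[OF unit_interval_subset] by simp

lemma convex_on_eff_dom: "convex_on (eff_dom \<psi>) f" and convex_eff_dom: "convex (eff_dom \<psi>)"
proof -
  have epi: "(x, f x) \<in> epi \<psi>" if "x \<in> eff_dom \<psi>" for x
    using psi_finite[OF that] by (simp add: epi_def)
  have combination: "\<psi> (u * x + v * y) \<le> ereal (u * f x + v * f y)"
    if "x \<in> eff_dom \<psi>" "y \<in> eff_dom \<psi>" "0 \<le> u" "0 \<le> v" "u + v = 1" for x y u v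
  proof -
    have "u *\<^sub>R (x, f x) + v *\<^sub>R (y, f y) \<in> epi \<psi>"
      using mirror epi that by (intro convexD) (auto simp: mirror_psi_def)
    then show ?thesis by (simp add: epi_def)
  qed
  show dom: "convex (eff_dom \<psi>)"
  proof (rule convexI)
    fix x y u v :: real
    assume "x \<in> eff_dom \<psi>" "y \<in> eff_dom \<psi>" "0 \<le> u" "0 \<le> v" "u + v = 1"
    from combination[OF this] show "u *\<^sub>R x + v *\<^sub>R y \<in> eff_dom \<psi>"
      by (auto simp: eff_dom_def intro: le_less_trans)
  qed
  show "convex_on (eff_dom \<psi>) f"
  proof (rule convex_onI[OF _ dom])
    fix t x y :: real
    assume t: "0 < t" "t < 1" and xy: "x \<in> eff_dom \<psi>" "y \<in> eff_dom \<psi>"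
    have "\<psi> ((1 - t) * x + t * y) \<le> ereal ((1 - t) * f x + t * f y)"
      using combination[OF xy, of "1 - t" t] t by simp
    moreover have "(1 - t) *\<^sub>R x + t *\<^sub>R y \<in> eff_dom \<psi>"
      using convexD[OF dom xy, of "1 - t" t] t by simp
    from psi_finite[OF this] obtain c where "\<psi> ((1 - t) *\<^sub>R x + t *\<^sub>R y) = ereal c" by blast
    ultimately show "f ((1 - t) *\<^sub>R x + t *\<^sub>R y) \<le> (1 - t) * f x + t * f y"
      by simp
  qed
qed

lemma psi_deriv_DERIV:
  assumes "x \<in> I" shows "(f has_real_derivative g x) (at x)"
proof -
  have "f differentiable (at x)"
    using mirror assms differentiable_on_eq_differentiable_at[OF open_interior]
    unfolding mirror_psi_def by blast
  then show ?thesis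
    unfolding psi_deriv_def by (simp add: DERIV_deriv_iff_real_differentiable)
qed

lemma psi_tangent:
  assumes "x \<in> I" "y \<in> eff_dom \<psi>" shows "f x + g x * (y - x) \<le> f y"
  using convex_on_imp_above_tangent[OF convex_on_eff_dom convex_connected[OF convex_eff_dom] assms
    has_field_derivative_at_within[OF psi_deriv_DERIV[OF assms(1)]]] by simp

text \<open>
  At the midpoint of \<open>x\<close> and \<open>y\<close> the graph lies strictly below the chord, yet not below the tangent
  at \<open>x\<close>.
\<close>

lemma psi_tangent_strict:
  assumes "x \<in> I" "y \<in> I" "x \<noteq> y" shows "f x + g x * (y - x) < f y"
proof -
  let ?m = "(x + y) / 2"
  have m: "?m = (1 - 1/2) * x + 1/2 * y" by (simp add: field_simps)
  have dom: "x \<in> eff_dom \<psi>" "y \<in> eff_dom \<psi>" using assms interior_subset by auto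
  have m_dom: "?m \<in> eff_dom \<psi>"
    using convexD[OF convex_eff_dom dom, of "1/2" "1/2"] by (simp add: field_simps)
  have "\<And>u. 0 < u \<and> u < 1 \<Longrightarrow> \<psi> ((1 - u) * x + u * y) < ereal (1 - u) * \<psi> x + ereal u * \<psi> y"
    using mirror assms unfolding mirror_psi_def by blast
  from this[of "1/2"] have "\<psi> ?m < ereal (1/2) * \<psi> x + ereal (1/2) * \<psi> y"
    unfolding m by simp
  moreover obtain a b c where "\<psi> x = ereal a" "\<psi> y = ereal b" "\<psi> ?m = ereal c"
    using psi_finite dom m_dom by blast
  ultimately have "f ?m < (f x + f y) / 2" by simp
  moreover have "f x + g x * (?m - x) \<le> f ?m" by (rule psi_tangent[OF assms(1) m_dom])
  ultimately show ?thesis by (simp add: field_simps)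
qed

lemma psi_deriv_strict_mono:
  assumes "x \<in> I" "y \<in> I" "x < y" shows "g x < g y"
proof -
  have "f x + g x * (y - x) < f y" "f y + g y * (x - y) < f x"
    using psi_tangent_strict assms by auto
  then have "g x * (y - x) < g y * (y - x)" by (simp add: algebra_simps)
  with assms(3) show ?thesis by simp
qed

text \<open>
  At a boundary point of the domain the derivative is unbounded in absolute value. As it
  increases, near a left endpoint it can only tend to \<open>-\<infinity>\<close>.
\<close>

lemma zero_in_interior:
  assumes finite_slope: "psi_deriv_at_0_right \<psi> > -\<infinity>"
  shows "0 \<in> I"
proof (rule ccontr)
  assume "0 \<notin> I"
  then have frontier: "0 \<in> frontier (eff_dom \<psi>)"
    using unit_interval_subset closure_subset[of "eff_dom \<psi>"] by (auto simp: frontier_def subset_iff)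
  define X where "X n = 1 / (real n + 2)" for n
  have X: "X n \<in> {0<..<1}" for n by (simp add: X_def)
  have X_lim: "X \<longlonglongrightarrow> 0" 
    unfolding X_def using LIMSEQ_ignore_initial_segment[OF lim_1_over_n[where 'a = real], of 2]
    by (simp add: add.commute)
  have X_half: "X n \<le> 1/2" for n by (simp add: X_def field_simps)
  have half: "1/2 \<in> I" using open_unit_interval_subset by (auto simp: subset_iff)
  have steep: "filterlim (\<lambda>n. \<bar>g (X n)\<bar>) at_top sequentially"
    using mirror frontier X X_lim open_unit_interval_subset unfolding mirror_psi_def by blast
  have "((\<lambda>x. ereal (g x)) \<longlongrightarrow> -\<infinity>) (at_right 0)"
  proof (rule tendsto_MInfty[THEN iffD2], rule allI)
    fix B
    obtain n where n: "\<bar>g (1/2)\<bar> + \<bar>B\<bar> + 1 \<le> \<bar>g (X n)\<bar>"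
      using steep by (auto simp: filterlim_at_top eventually_sequentially)
    have "g (X n) \<le> g (1/2)"
    proof (cases "X n < 1/2")
      case True
      then show ?thesis
        using psi_deriv_strict_mono[of "X n" "1/2"] half X[of n] open_unit_interval_subset by fastforce
    next
      case False
      with X_half[of n] have "X n = 1/2" by linarith
      then show ?thesis by (simp only:)
    qed
    with n have B: "g (X n) < B" by linarith
    have "eventually (\<lambda>x. x \<in> {0<..<X n}) (at_right 0)"
      using X[of n] by (intro eventually_at_right_real) simp
    then show "eventually (\<lambda>x. ereal (g x) < ereal B) (at_right 0)"
    proof eventually_elim
      case (elim x)
      then have "g x < g (X n)"
        using X[of n] open_unit_interval_subset by (intro psi_deriv_strict_mono) (auto simp: subset_iff)
      with B show ?case by simp
    qed
  qed
  then have "psi_deriv_at_0_right \<psi> = -\<infinity>"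
    unfolding psi_deriv_at_0_right_def by (intro tendsto_Lim) simp_all
  with finite_slope show False by simp
qed

text \<open>
  The one-sided limit is given by \<open>Lim\<close>, which says something only if a limit exists. A bounded
  increasing derivative does converge, to its supremum, which is then a finite limit.
\<close>

lemma psi_deriv_unbounded:
  assumes infinite_slope: "psi_deriv_at_1_left \<psi> = \<infinity>"
  shows "\<exists>x. 0 < x \<and> x < 1 \<and> B < g x"
proof (rule ccontr)
  assume "\<not> ?thesis"
  then have bound: "g x \<le> B" if "0 < x" "x < 1" for x using that by force
  define L where "L = (SUP x\<in>{0<..<1}. g x)"
  have bdd: "bdd_above (g ` {0<..<1})" using bound by (auto intro!: bdd_aboveI)
  have "(g \<longlongrightarrow> L) (at_left 1)"
  proof (rule order_tendstoI)
    fix l assume "L < l"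
    have "eventually (\<lambda>x. x \<in> {0<..<1}) (at_left (1::real))" by (rule eventually_at_left_real) simp
    then show "eventually (\<lambda>x. g x < l) (at_left 1)"
    proof eventually_elim
      case (elim x)
      then have "g x \<le> L" unfolding L_def by (intro cSUP_upper bdd)
      with \<open>L < l\<close> show ?case by simp
    qed
  next
    fix l assume "l < L"
    then obtain x where x: "0 < x" "x < 1" "l < g x"
      unfolding L_def by (auto simp: less_cSUP_iff[OF _ bdd])
    have "eventually (\<lambda>y. y \<in> {x<..<1}) (at_left 1)" using x by (intro eventually_at_left_real) simp
    then show "eventually (\<lambda>y. l < g y) (at_left 1)"
    proof eventually_elim
      case (elim y)
      then have "g x < g y"
        using x open_unit_interval_subset by (intro psi_deriv_strict_mono) (auto simp: subset_iff)
      with x show ?case by simp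
    qed
  qed
  then have "((\<lambda>x. ereal (g x)) \<longlongrightarrow> ereal L) (at_left 1)" by simp
  then have "psi_deriv_at_1_left \<psi> = ereal L"
    unfolding psi_deriv_at_1_left_def by (intro tendsto_Lim) simp_all
  with infinite_slope show False by simp
qed

lemma one_notin_interior:
  assumes "psi_deriv_at_1_left \<psi> = \<infinity>"
  shows "1 \<notin> I"
proof
  assume "1 \<in> I"
  obtain x where "0 < x" "x < 1" "g 1 < g x" using psi_deriv_unbounded[OF assms] by blast
  moreover have "g x < g 1"
    using \<open>1 \<in> I\<close> \<open>0 < x\<close> \<open>x < 1\<close> open_unit_interval_subset
    by (intro psi_deriv_strict_mono) (auto simp: subset_iff)
  ultimately show False by simp
qed

lemma interior_eff_dom_unit:
  assumes "psi_deriv_at_0_right \<psi> > -\<infinity>" "psi_deriv_at_1_left \<psi> = \<infinity>" "0 \<le> x" "x \<le> 1"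
  shows "x \<in> I \<longleftrightarrow> x < 1"
  using zero_in_interior one_notin_interior open_unit_interval_subset assms
  by (cases "x = 0"; cases "x = 1") auto

lemma scalar_mirror_psi:
  assumes "psi_deriv_at_0_right \<psi> > -\<infinity>" "psi_deriv_at_1_left \<psi> = \<infinity>"
  shows "scalar_mirror (\<lambda>x. real_of_ereal (\<psi> x)) (psi_deriv \<psi>)"
proof
  note I = interior_eff_dom_unit[OF assms]
  show "(f has_real_derivative g x) (at x)" if "0 \<le> x" "x < 1" for x
    using that I by (intro psi_deriv_DERIV) auto
  show "f x + g x * (y - x) \<le> f y" if "0 \<le> x" "x < 1" "0 \<le> y" "y \<le> 1" for x y
    using that I unit_interval_subset by (intro psi_tangent) auto
  show "g x < g y" if "0 \<le> x" "x < y" "y < 1" for x y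
    using that I by (intro psi_deriv_strict_mono) auto
  show "\<exists>x. 0 < x \<and> x < 1 \<and> B < g x" for B
    by (rule psi_deriv_unbounded[OF assms(2)])
qed

end

section \<open>A single mirror ascent step on the simplex\<close>

definition prob_simplex :: "('a::finite \<Rightarrow> real) set"
  where "prob_simplex = {p. (\<forall>a. 0 \<le> p a) \<and> (\<Sum>a\<in>UNIV. p a) = 1}"

lemma prob_simplexD:
  assumes "p \<in> prob_simplex"
  shows "0 \<le> p a" "p a \<le> 1" "(\<Sum>a\<in>UNIV. p a) = 1"
proof -
  show "0 \<le> p a" and "(\<Sum>a\<in>UNIV. p a) = 1" using assms by (simp_all add: prob_simplex_def)
  have "p a \<le> (\<Sum>a\<in>UNIV. p a)"
    using assms by (intro member_le_sum) (auto simp: prob_simplex_def)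
  then show "p a \<le> 1" using assms by (simp add: prob_simplex_def)
qed

lemma prob_simplex_convex:
  assumes "p \<in> prob_simplex" "q \<in> prob_simplex" "0 \<le> t" "t \<le> 1"
  shows "(\<lambda>a. p a + t * (q a - p a)) \<in> prob_simplex"
proof -
  have "p a + t * (q a - p a) = (1 - t) * p a + t * q a" for a by (simp add: algebra_simps)
  then have "0 \<le> p a + t * (q a - p a)" for a using assms by (auto simp: prob_simplex_def)
  moreover have "(\<Sum>a\<in>UNIV. p a + t * (q a - p a)) = 1"
    using assms by (simp add: sum.distrib sum_subtractf flip: sum_distrib_left) (simp add: prob_simplex_def)
  ultimately show ?thesis by (simp add: prob_simplex_def)
qed

text \<open>
  Moving mass from one action to another is the only kind of perturbation from which the
  optimality conditions are extracted below.
\<close>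

lemma sum_shift_mass:
  fixes p w :: "'a::finite \<Rightarrow> real"
  assumes "a \<noteq> b"
  shows "(\<Sum>c\<in>UNIV. w c * ((p(a := p a - t, b := p b + t)) c - p c)) = t * (w b - w a)"
proof -
  have "(\<Sum>c\<in>UNIV. w c * ((p(a := p a - t, b := p b + t)) c - p c)) =
      (\<Sum>c\<in>UNIV. (if c = a then - t * w a else 0) + (if c = b then t * w b else 0))"
    using assms by (intro sum.cong) auto
  then show ?thesis by (simp add: sum.distrib algebra_simps)
qed

lemma prob_simplex_shift_mass:
  assumes "p \<in> prob_simplex" "a \<noteq> b" "0 \<le> t" "t \<le> p a"
  shows "p(a := p a - t, b := p b + t) \<in> prob_simplex"
proof -
  have "(\<Sum>c\<in>UNIV. (p(a := p a - t, b := p b + t)) c) = 1"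
    using sum_shift_mass[OF assms(2), of "\<lambda>_. 1" p t] prob_simplexD(3)[OF assms(1)]
    by (simp add: sum_subtractf del: fun_upd_apply)
  then show ?thesis using assms by (simp add: prob_simplex_def del: fun_upd_apply) simp
qed

context scalar_mirror
begin

definition divergence :: "('a::finite \<Rightarrow> real) \<Rightarrow> ('a \<Rightarrow> real) \<Rightarrow> real"
  where "divergence p q = (\<Sum>a\<in>UNIV. f (p a) - f (q a) - g (q a) * (p a - q a))"

lemma divergence_nonneg:
  assumes "p \<in> prob_simplex" "q \<in> prob_simplex" "\<And>a. q a < 1"
  shows "0 \<le> divergence p q"
  unfolding divergence_def
proof (rule sum_nonneg)
  fix a
  show "0 \<le> f (p a) - f (q a) - g (q a) * (p a - q a)"
    using tangent[of "q a" "p a"] prob_simplexD[OF assms(1)] prob_simplexD[OF assms(2)] assms(3) by simp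
qed

lemma deriv_mono: "0 \<le> x \<Longrightarrow> x \<le> y \<Longrightarrow> y < 1 \<Longrightarrow> g x \<le> g y"
  using deriv_strict_mono[of x y] by (cases "x = y") auto

lemma deriv_monotone_product:
  assumes "0 \<le> x" "x < 1" "0 \<le> y" "y < 1"
  shows "0 \<le> (g x - g y) * (x - y)"
  using deriv_mono[of x y] deriv_mono[of y x] assms
  by (cases "x \<le> y") (auto intro: mult_nonneg_nonneg mult_nonpos_nonpos)

end

text \<open>
  One update: \<open>x\<close> maximises the linear payoff \<open>w\<close> penalised by the divergence from \<open>q\<close>. The step
  size is absorbed into \<open>w\<close>.
\<close>

locale mirror_step = scalar_mirror +
  fixes w q x :: "'a::finite \<Rightarrow> real"
  assumes q_simplex: "q \<in> prob_simplex" and q_less_1: "q a < 1"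
    and x_simplex: "x \<in> prob_simplex"
    and maximal: "z \<in> prob_simplex \<Longrightarrow>
      (\<Sum>a\<in>UNIV. z a * w a) - divergence z q \<le> (\<Sum>a\<in>UNIV. x a * w a) - divergence x q"
    and several_actions: "card (UNIV :: 'a set) > 1"
begin

lemmas q_bounds = prob_simplexD[OF q_simplex]
lemmas x_bounds = prob_simplexD[OF x_simplex]

lemma objective_difference:
  "((\<Sum>a\<in>UNIV. z a * w a) - divergence z q) - ((\<Sum>a\<in>UNIV. x a * w a) - divergence x q) =
    (\<Sum>a\<in>UNIV. (w a + g (q a)) * (z a - x a)) - (\<Sum>a\<in>UNIV. f (z a) - f (x a))"
  unfolding divergence_def by (simp add: sum_subtractf[symmetric] algebra_simps)

text \<open>
  At a vertex of the simplex the objective has slope \<open>+\<infinity>\<close> in the direction of any other action: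
  moving mass \<open>t\<close> from \<open>a\<close> to \<open>b\<close> gains at least \<open>t * g (1 - t)\<close> up to an error of order \<open>t\<close>, and
  \<open>g (1 - t)\<close> is unbounded. Optimality would bound \<open>g\<close> on \<open>(0, 1)\<close>.
\<close>

lemma x_less_1: "x a < 1"
proof (rule ccontr)
  assume "\<not> x a < 1"
  then have xa: "x a = 1" using x_bounds(2)[of a] by simp
  obtain b where b: "b \<noteq> a"
  proof -
    have "UNIV \<noteq> {a}" using several_actions
      by (metis One_nat_def card.empty card_insert_disjoint empty_iff finite.emptyI less_irrefl)
    then show thesis using that by auto
  qed
  have "x a + x b \<le> 1"
  proof -
    have "(\<Sum>c\<in>{a, b}. x c) \<le> (\<Sum>c\<in>UNIV. x c)"
      using x_bounds by (intro sum_mono2) auto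
    then show ?thesis using b x_bounds by simp
  qed
  then have xb: "x b = 0" using xa x_bounds(1)[of b] by simp
  \<comment> \<open>Here \<open>s = 1 - t\<close> is what remains at \<open>a\<close> after moving mass \<open>t\<close> to \<open>b\<close>; the cost at \<open>b\<close> is at
    most \<open>t * g t\<close> and is controlled for \<open>t \<le> 1/2\<close>.\<close>
  let ?c = "\<lambda>c. w c + g (q c)"
  have bound: "g s \<le> max (g (1/2)) (?c a - ?c b + g (1/2))" if s: "0 < s" "s < 1" for s
  proof (cases "s < 1/2")
    case True
    then show ?thesis using deriv_mono[of s "1/2"] s by simp
  next
    case False
    define t where "t = 1 - s"
    have t: "0 < t" "t \<le> 1/2" using s False by (simp_all add: t_def)
    let ?z = "x(a := x a - t, b := x b + t)"
    have "(\<Sum>c\<in>UNIV. f (?z c) - f (x c)) = (\<Sum>c\<in>{a, b}. f (?z c) - f (x c))"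
      by (rule sum.mono_neutral_right) auto
    also have "\<dots> = f s - f 1 + (f t - f 0)"
      using b xa xb by (simp add: t_def)
    finally have "t * (?c b - ?c a) - (f s - f 1 + (f t - f 0)) \<le> 0"
      using objective_difference[of ?z] maximal[OF prob_simplex_shift_mass[OF x_simplex b[symmetric], of t]]
        sum_shift_mass[OF b[symmetric], of ?c x t] t xa by simp
    moreover have "f s + g s * t \<le> f 1" using tangent[of s 1] s by (simp add: t_def)
    moreover have "f t - g t * t \<le> f 0" using tangent[of t 0] t by (simp add: algebra_simps)
    ultimately have "t * g s \<le> t * (?c a - ?c b + g t)" by (simp add: algebra_simps)
    then have "g s \<le> ?c a - ?c b + g t" using t by simp
    moreover have "g t \<le> g (1/2)" using deriv_mono[of t "1/2"] t by simp
    ultimately show ?thesis by simp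
  qed
  show False using deriv_unbounded[of "max (g (1/2)) (?c a - ?c b + g (1/2))"] bound by force
qed

text \<open>
  First-order optimality: the derivative of the objective along the segment towards \<open>z\<close> is not
  positive.
\<close>

lemma variational_inequality:
  assumes z: "z \<in> prob_simplex"
  shows "(\<Sum>a\<in>UNIV. (w a + g (q a) - g (x a)) * (z a - x a)) \<le> 0"
proof (rule ccontr)
  assume "\<not> ?thesis"
  then have pos: "0 < (\<Sum>a\<in>UNIV. (w a + g (q a) - g (x a)) * (z a - x a))" by simp
  define \<phi> where "\<phi> t = (\<Sum>a\<in>UNIV. (w a + g (q a)) * ((x a + t * (z a - x a)) - x a))
    - (\<Sum>a\<in>UNIV. f (x a + t * (z a - x a)) - f (x a))" for t
  have f_path: "((\<lambda>t. f (x a + t * (z a - x a))) has_real_derivative g (x a) * (z a - x a)) (at 0)" for a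
  proof (rule DERIV_chain2[where f = f and g = "\<lambda>t. x a + t * (z a - x a)"])
    show "(f has_real_derivative g (x a)) (at (x a + 0 * (z a - x a)))"
      using deriv x_bounds(1) x_less_1 by simp
    show "((\<lambda>t. x a + t * (z a - x a)) has_real_derivative (z a - x a)) (at 0)"
      by (auto intro!: derivative_eq_intros)
  qed
  have linear_path: "((\<lambda>t. (w a + g (q a)) * (x a + t * (z a - x a) - x a)) has_real_derivative
      (w a + g (q a)) * (z a - x a)) (at 0)" for a
    by (auto intro!: derivative_eq_intros)
  have f_path': "((\<lambda>t. f (x a + t * (z a - x a)) - f (x a)) has_real_derivative g (x a) * (z a - x a)) (at 0)" for a
    using DERIV_diff[OF f_path DERIV_const] by simp
  have "(\<phi> has_real_derivative (\<Sum>a\<in>UNIV. (w a + g (q a)) * (z a - x a)) - (\<Sum>a\<in>UNIV. g (x a) * (z a - x a))) (at 0)"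
    unfolding \<phi>_def[abs_def]
    by (intro DERIV_diff DERIV_sum linear_path f_path')
  also have "(\<Sum>a\<in>UNIV. (w a + g (q a)) * (z a - x a)) - (\<Sum>a\<in>UNIV. g (x a) * (z a - x a)) =
      (\<Sum>a\<in>UNIV. (w a + g (q a) - g (x a)) * (z a - x a))"
    by (simp add: sum_subtractf[symmetric] algebra_simps)
  finally obtain d where d: "0 < d" "\<And>t. 0 < t \<Longrightarrow> t < d \<Longrightarrow> \<phi> 0 < \<phi> (0 + t)"
    using DERIV_pos_inc_right[OF _ pos] by blast
  define t where "t = min 1 (d / 2)"
  have t: "0 < t" "t < d" "t \<le> 1" using d(1) by (auto simp: t_def)
  have "\<phi> t \<le> 0"
    using maximal[OF prob_simplex_convex[OF x_simplex z, of t]] t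
      objective_difference[of "\<lambda>a. x a + t * (z a - x a)"] by (simp add: \<phi>_def)
  moreover have "\<phi> 0 = 0" by (simp add: \<phi>_def)
  ultimately show False using d(2)[OF t(1,2)] by simp
qed

text \<open>
  The variational inequality expressed in divergences. Its use is to make \<open>divergence z q\<close>
  telescope along a sequence of steps for a fixed comparator \<open>z\<close>.
\<close>

lemma three_point:
  assumes z: "z \<in> prob_simplex"
  shows "(\<Sum>a\<in>UNIV. z a * w a) + divergence z x \<le> (\<Sum>a\<in>UNIV. x a * w a) + divergence z q"
proof -
  have "(\<Sum>a\<in>UNIV. z a * w a) + divergence z x - ((\<Sum>a\<in>UNIV. x a * w a) + divergence z q) + divergence x q =
      (\<Sum>a\<in>UNIV. (w a + g (q a) - g (x a)) * (z a - x a))"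
    unfolding divergence_def by (simp add: sum_subtractf[symmetric] sum.distrib[symmetric] algebra_simps)
  then show ?thesis
    using variational_inequality[OF z] divergence_nonneg[OF x_simplex q_simplex q_less_1] by simp
qed

text \<open>
  The variational inequality with the old point \<open>q\<close> as comparator. The left-hand side is the
  symmetrised divergence of \<open>x\<close> and \<open>q\<close>; strict monotonicity of \<open>g\<close> makes it vanish only if \<open>x = q\<close>.
\<close>
lemma payoff_gain_ge:
  "(\<Sum>a\<in>UNIV. (g (x a) - g (q a)) * (x a - q a)) \<le> (\<Sum>a\<in>UNIV. x a * w a) - (\<Sum>a\<in>UNIV. q a * w a)"
proof -
  have "(\<Sum>a\<in>UNIV. (g (x a) - g (q a)) * (x a - q a)) =
    (\<Sum>a\<in>UNIV. x a * w a) - (\<Sum>a\<in>UNIV. q a * w a) + (\<Sum>a\<in>UNIV. (w a + g (q a) - g (x a)) * (q a - x a))"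
    by (simp add: sum_subtractf[symmetric] sum.distrib[symmetric] algebra_simps)
  then show ?thesis using variational_inequality[OF q_simplex] by simp
qed

lemma monotone_product_nonneg: "0 \<le> (g (x a) - g (q a)) * (x a - q a)"
  by (intro deriv_monotone_product x_bounds q_bounds x_less_1 q_less_1)

lemma improvement: "(\<Sum>a\<in>UNIV. q a * w a) \<le> (\<Sum>a\<in>UNIV. x a * w a)"
proof -
  have "0 \<le> (\<Sum>a\<in>UNIV. (g (x a) - g (q a)) * (x a - q a))"
    by (intro sum_nonneg monotone_product_nonneg)
  with payoff_gain_ge show ?thesis by simp
qed

lemma no_improvement_imp_fixed:
  assumes "(\<Sum>a\<in>UNIV. x a * w a) \<le> (\<Sum>a\<in>UNIV. q a * w a)"
  shows "x = q"
proof (rule ext)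
  fix a
  have "(\<Sum>a\<in>UNIV. (g (x a) - g (q a)) * (x a - q a)) = 0"
    using payoff_gain_ge assms sum_nonneg[of UNIV "\<lambda>a. (g (x a) - g (q a)) * (x a - q a)"]
      monotone_product_nonneg by (simp add: order_antisym)
  then have "(g (x a) - g (q a)) * (x a - q a) = 0"
    using monotone_product_nonneg by (simp add: sum_nonneg_eq_0_iff)
  then show "x a = q a"
    using deriv_strict_mono[of "x a" "q a"] deriv_strict_mono[of "q a" "x a"] x_bounds q_bounds x_less_1 q_less_1
    by (cases "x a" "q a" rule: linorder_cases) auto
qed

text \<open>
  The Lagrange multiplier of the constraint that the probabilities sum to \<open>1\<close>. The maximum is
  attained at every action in the support of \<open>x\<close>: otherwise shifting mass from such an action to
  a maximiser would improve the objective.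
\<close>

definition multiplier :: real
  where "multiplier = Max (range (\<lambda>a. w a + g (q a) - g (x a)))"

lemma deriv_step_ge: "g (q a) + w a - multiplier \<le> g (x a)"
proof -
  have "w a + g (q a) - g (x a) \<le> multiplier" unfolding multiplier_def by simp
  then show ?thesis by simp
qed

lemma deriv_step_eq:
  assumes "0 < x a"
  shows "g (x a) = g (q a) + w a - multiplier"
proof -
  let ?c = "\<lambda>a. w a + g (q a) - g (x a)"
  have "?c b \<le> ?c a" for b
  proof (cases "b = a")
    case False
    have "x a * (?c b - ?c a) \<le> 0"
      using variational_inequality[OF prob_simplex_shift_mass[OF x_simplex False[symmetric], of "x a"]]
      by (simp only: sum_shift_mass[OF False[symmetric], of ?c]) (use x_bounds in simp)
    then show ?thesis using assms by (simp add: mult_le_0_iff)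
  qed simp
  then have "multiplier \<le> ?c a" unfolding multiplier_def by (subst Max_le_iff) auto
  then show ?thesis using deriv_step_ge[of a] by simp
qed

text \<open>
  A multiplier above every payoff would make each positive probability strictly smaller than
  before, and the probabilities could not sum to \<open>1\<close>.
\<close>

lemma multiplier_le:
  assumes "\<And>a. w a \<le> c"
  shows "multiplier \<le> c"
proof (rule ccontr)
  assume above: "\<not> multiplier \<le> c"
  have dec: "x a < q a" if "0 < x a" for a
  proof (rule ccontr)
    assume "\<not> x a < q a"
    then have "g (q a) \<le> g (x a)" by (intro deriv_mono q_bounds x_less_1) simp
    then show False using deriv_step_eq[OF that] assms[of a] above by simp
  qed
  then have le: "x a \<le> q a" for a using dec[of a] x_bounds(1)[of a] q_bounds(1)[of a] by linarith
  obtain a where "x a \<noteq> 0" using x_bounds(3) by (metis sum.neutral zero_neq_one)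
  then have "x a < q a" using dec x_bounds(1)[of a] by simp
  then have "(\<Sum>a\<in>UNIV. x a) < (\<Sum>a\<in>UNIV. q a)"
    using le by (intro sum_strict_mono_ex1) auto
  then show False using x_bounds(3) q_bounds(3) by simp
qed

end

section \<open>The update of policy mirror descent as a mirror ascent step\<close>

context
  fixes \<psi> :: "real \<Rightarrow> ereal"
  assumes mirror: "mirror_psi \<psi>"
begin

lemma mirror_h_eq:
  assumes "\<And>a. p $ a \<in> eff_dom \<psi>"
  shows "mirror_h \<psi> p = ereal (\<Sum>a\<in>UNIV. real_of_ereal (\<psi> (p $ a)))"
proof -
  have "mirror_h \<psi> p = (\<Sum>a\<in>UNIV. ereal (real_of_ereal (\<psi> (p $ a))))"
    unfolding mirror_h_def using psi_finite[OF mirror assms] by (intro sum.cong refl)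
  then show ?thesis by simp
qed

text \<open>
  The real-valued version of \<open>mirror_h\<close> is a sum of functions of one coordinate only where all
  coordinates lie in the domain, so the derivative is transferred on the open set of vectors with
  coordinates in the interior.
\<close>

lemma gradient_mirror_h:
  fixes q :: "real ^ 'a::finite"
  assumes "\<And>a. q $ a \<in> interior (eff_dom \<psi>)"
  shows "gradient (\<lambda>x. real_of_ereal (mirror_h \<psi> x)) q = (\<chi> a. psi_deriv \<psi> (q $ a))"
proof -
  let ?F = "\<lambda>x :: real ^ 'a. real_of_ereal (mirror_h \<psi> x)"
  let ?D = "\<chi> a. psi_deriv \<psi> (q $ a)"
  define S where "S = {x :: real ^ 'a. \<forall>a. x $ a \<in> interior (eff_dom \<psi>)}"
  have "S = (\<Inter>a. (\<lambda>x. x $ a) -` interior (eff_dom \<psi>))" by (auto simp: S_def)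
  then have "open S" by (auto intro!: open_INT open_vimage_vec_nth)
  have coordinate: "((\<lambda>x :: real ^ 'a. real_of_ereal (\<psi> (x $ a))) has_derivative
      (\<lambda>h. psi_deriv \<psi> (q $ a) * (h $ a))) (at q)" for a
  proof -
    have "((\<lambda>x. x $ a) has_derivative (\<lambda>h. h $ a)) (at q)"
      by (rule bounded_linear_imp_has_derivative[OF bounded_linear_vec_nth])
    moreover have "((\<lambda>x. real_of_ereal (\<psi> x)) has_derivative (\<lambda>y. psi_deriv \<psi> (q $ a) * y)) (at (q $ a))"
      using psi_deriv_DERIV[OF mirror assms[of a]] by (simp add: has_field_derivative_def)
    ultimately show ?thesis by (rule has_derivative_compose)
  qed
  have "((\<lambda>x. \<Sum>a\<in>UNIV. real_of_ereal (\<psi> (x $ a))) has_derivative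
      (\<lambda>h. \<Sum>a\<in>UNIV. psi_deriv \<psi> (q $ a) * (h $ a))) (at q)"
    by (intro has_derivative_sum coordinate)
  then have "(?F has_derivative (\<lambda>h. \<Sum>a\<in>UNIV. psi_deriv \<psi> (q $ a) * (h $ a))) (at q)"
  proof (rule has_derivative_transform_within_open[OF _ \<open>open S\<close>])
    show "q \<in> S" using assms by (simp add: S_def)
    fix x assume "x \<in> S"
    then have "x $ a \<in> eff_dom \<psi>" for a using interior_subset by (auto simp: S_def)
    from mirror_h_eq[OF this] show "(\<Sum>a\<in>UNIV. real_of_ereal (\<psi> (x $ a))) = ?F x" by simp
  qed
  then have grad: "GDERIV ?F q :> ?D"
    by (simp add: gderiv_def inner_vec_def mult.commute)
  show ?thesis
    unfolding gradient_def
  proof (rule the_equality[of "\<lambda>D. GDERIV ?F q :> D", OF grad])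
    fix D assume "GDERIV ?F q :> D"
    then have "(\<lambda>h. inner h D) = (\<lambda>h. inner h ?D)"
      using grad unfolding gderiv_def by (rule has_derivative_unique)
    then have "inner (D - ?D) D = inner (D - ?D) ?D" by metis
    then have "inner (D - ?D) (D - ?D) = 0" by (simp add: inner_diff_right)
    then show "D = ?D" by simp
  qed
qed

lemma pmd_objective_eq:
  fixes p :: "'a::finite pmf"
  assumes q: "\<And>a. pmf (\<pi> s) a \<in> interior (eff_dom \<psi>)"
    and p: "\<And>a. pmf p a \<in> eff_dom \<psi>"
  shows "pmd_objective P r \<gamma> \<psi> \<eta> \<pi> s p =
    ereal ((\<Sum>a\<in>UNIV. pmf p a * (\<eta> * Q_val P r \<gamma> \<pi> s a)) -
      (\<Sum>a\<in>UNIV. real_of_ereal (\<psi> (pmf p a)) - real_of_ereal (\<psi> (pmf (\<pi> s) a))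
         - psi_deriv \<psi> (pmf (\<pi> s) a) * (pmf p a - pmf (\<pi> s) a)))"
proof -
  have q': "prob_vec (\<pi> s) $ a \<in> interior (eff_dom \<psi>)" for a using q by (simp add: prob_vec_def)
  have "prob_vec (\<pi> s) $ a \<in> eff_dom \<psi>" for a using q' interior_subset by blast
  moreover have "prob_vec p $ a \<in> eff_dom \<psi>" for a using p by (simp add: prob_vec_def)
  ultimately have h: "mirror_h \<psi> (prob_vec p) = ereal (\<Sum>a\<in>UNIV. real_of_ereal (\<psi> (pmf p a)))"
    "mirror_h \<psi> (prob_vec (\<pi> s)) = ereal (\<Sum>a\<in>UNIV. real_of_ereal (\<psi> (pmf (\<pi> s) a)))"
    using mirror_h_eq[of "prob_vec p"] mirror_h_eq[of "prob_vec (\<pi> s)"] by (simp_all add: prob_vec_def)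
  show ?thesis
    unfolding pmd_objective_def bregman_def h gradient_mirror_h[OF q']
    by (simp add: inner_vec_def prob_vec_def sum_distrib_left sum_subtractf mult_ac)
qed

end

lemma pmf_in_simplex: "pmf (p :: 'a::finite pmf) \<in> prob_simplex"
  by (simp add: prob_simplex_def sum_pmf_eq_1)

lemma prob_simplex_pmf:
  assumes "z \<in> prob_simplex"
  obtains p :: "'a::finite pmf" where "pmf p = z"
proof
  have "(\<integral>\<^sup>+a. ennreal (z a) \<partial>count_space UNIV) = 1"
    using prob_simplexD[OF assms] by (simp add: nn_integral_count_space_finite)
  then show "pmf (embed_pmf z) = z"
    using prob_simplexD(1)[OF assms] by (intro ext pmf_embed_pmf) auto
qed

text \<open>
  The divergence from \<open>\<pi> k\<close> is meaningful only if \<open>\<pi> k\<close> has its probabilities in the interior of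
  the domain, that is, below \<open>1\<close>. Each maximiser again has this property (\<open>x_less_1\<close>), so it
  propagates from the initial policy.
\<close>

lemma pmd_mirror_step:
  fixes \<pi> :: "nat \<Rightarrow> 's::finite \<Rightarrow> 'a::finite pmf"
  assumes mirror: "mirror_psi \<psi>"
    and slopes: "psi_deriv_at_0_right \<psi> > -\<infinity>" "psi_deriv_at_1_left \<psi> = \<infinity>"
    and pmd: "pmd_sequence P r \<gamma> \<psi> \<eta> \<pi>"
    and actions: "card (UNIV :: 'a set) > 1"
  shows "mirror_step (\<lambda>x. real_of_ereal (\<psi> x)) (psi_deriv \<psi>) (\<lambda>a. \<eta> * Q_val P r \<gamma> (\<pi> k) s a)
    (pmf (\<pi> k s)) (pmf (\<pi> (Suc k) s))"
proof -
  let ?f = "\<lambda>x. real_of_ereal (\<psi> x)" and ?g = "psi_deriv \<psi>"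
  interpret scalar_mirror ?f ?g by (rule scalar_mirror_psi[OF mirror slopes])
  have interior_iff: "pmf p a \<in> interior (eff_dom \<psi>) \<longleftrightarrow> pmf p a < 1" for p :: "'a pmf" and a
    by (rule interior_eff_dom_unit[OF mirror slopes]) (simp_all add: pmf_le_1)
  have dom: "pmf p a \<in> eff_dom \<psi>" for p :: "'a pmf" and a
    using unit_interval_subset[OF mirror] by (auto simp: pmf_le_1)
  have step: "mirror_step ?f ?g (\<lambda>a. \<eta> * Q_val P r \<gamma> (\<pi> k) s a) (pmf (\<pi> k s)) (pmf (\<pi> (Suc k) s))"
    if less: "\<And>a. pmf (\<pi> k s) a < 1" for k s
  proof (unfold_locales)
    fix z :: "'a \<Rightarrow> real" assume "z \<in> prob_simplex"
    then obtain p where p: "pmf p = z" by (rule prob_simplex_pmf)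
    have "\<not> pmd_objective P r \<gamma> \<psi> \<eta> (\<pi> k) s (\<pi> (Suc k) s) < pmd_objective P r \<gamma> \<psi> \<eta> (\<pi> k) s p"
      using pmd by (auto simp: pmd_sequence_def is_arg_max_def)
    then show "(\<Sum>a\<in>UNIV. z a * (\<eta> * Q_val P r \<gamma> (\<pi> k) s a)) - divergence z (pmf (\<pi> k s)) \<le>
        (\<Sum>a\<in>UNIV. pmf (\<pi> (Suc k) s) a * (\<eta> * Q_val P r \<gamma> (\<pi> k) s a))
          - divergence (pmf (\<pi> (Suc k) s)) (pmf (\<pi> k s))"
      using less by (simp add: pmd_objective_eq[OF mirror _ dom] interior_iff divergence_def flip: p)
  qed (use less actions in \<open>auto simp: pmf_in_simplex\<close>)
  have "pmf (\<pi> k s) a < 1" for k s a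
  proof (induction k arbitrary: a)
    case 0
    then show ?case using pmd interior_iff by (auto simp: pmd_sequence_def)
  next
    case (Suc k)
    from mirror_step.x_less_1[OF step[OF Suc.IH]] show ?case .
  qed
  then show ?thesis by (rule step)
qed

section \<open>Extinction of suboptimal actions\<close>

text \<open>
  The heart of the argument, for a single state: \<open>Qk k\<close> are action values that converge from
  below, with summable errors, to \<open>Qlim\<close>, whose maximum \<open>v\<close> is attained at least twice.
\<close>

lemma (in scalar_mirror) suboptimal_action_extinct:
  fixes x :: "nat \<Rightarrow> 'a::finite \<Rightarrow> real"
  assumes step: "\<And>k. mirror_step f g (\<lambda>a. \<eta> * Qk k a) (x k) (x (Suc k))"
    and \<eta>: "0 < \<eta>"
    and below: "\<And>k a. Qk k a \<le> Qlim a" and best: "\<And>a. Qlim a \<le> v"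
    and summable: "\<And>a. summable (\<lambda>k. Qlim a - Qk k a)"
    and optimal: "b \<noteq> b'" "Qlim b = v" "Qlim b' = v"
    and suboptimal: "Qlim a < v"
  shows "eventually (\<lambda>k. x k a = 0) sequentially"
proof -
  interpret S: mirror_step f g "\<lambda>a. \<eta> * Qk k a" "x k" "x (Suc k)" for k by (rule step)
  define u where "u k = \<eta> * v - S.multiplier k" for k
  have u_nonneg: "0 \<le> u k" for k
  proof -
    have "\<eta> * Qk k a \<le> \<eta> * v" for a using below[of k a] best[of a] \<eta> by simp
    from S.multiplier_le[of k, OF this] show ?thesis by (simp add: u_def)
  qed
  \<comment> \<open>For optimal actions the derivative accumulates all of \<open>u\<close>, up to the summable errors.\<close>
  have growth: "g 0 + (\<Sum>k<N. u k) - \<eta> * (\<Sum>k. Qlim d - Qk k d) \<le> g (x N d)"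
    if "Qlim d = v" for N d
  proof -
    have "g (x 0 d) + (\<Sum>k<N. u k) - \<eta> * (\<Sum>k<N. Qlim d - Qk k d) \<le> g (x N d)"
    proof (induction N)
      case (Suc N)
      then show ?case
        using S.deriv_step_ge[of N d] by (simp add: u_def algebra_simps that)
    qed simp
    moreover have "\<eta> * (\<Sum>k<N. Qlim d - Qk k d) \<le> \<eta> * (\<Sum>k. Qlim d - Qk k d)"
      using below \<eta> by (intro mult_left_mono sum_le_suminf summable) auto
    moreover have "g 0 \<le> g (x 0 d)"
      using S.q_bounds(1)[of 0 d] S.q_less_1[of 0 d] by (intro deriv_mono) auto
    ultimately show ?thesis by linarith
  qed
  have "summable u"
  proof (rule summableI_nonneg_bounded[OF u_nonneg])
    fix N
    let ?E = "\<lambda>d. \<eta> * (\<Sum>k. Qlim d - Qk k d)"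
    have E_nonneg: "0 \<le> ?E d" for d
      using below \<eta> by (intro mult_nonneg_nonneg suminf_nonneg summable) auto
    \<comment> \<open>One of the two optimal actions has probability at most \<open>1/2\<close> at time \<open>N\<close>; which one may
      depend on \<open>N\<close>, so the bound adds the errors of both.\<close>
    have "(\<Sum>c\<in>{b, b'}. x N c) \<le> (\<Sum>c\<in>UNIV. x N c)"
      using S.q_bounds(1) by (intro sum_mono2) auto
    then have "x N b + x N b' \<le> 1" using optimal(1) S.q_bounds(3) by simp
    then have "x N b \<le> 1/2 \<or> x N b' \<le> 1/2" by linarith
    then obtain d where d: "d \<in> {b, b'}" "x N d \<le> 1/2" by blast
    then have "g (x N d) \<le> g (1/2)" using S.q_bounds(1) by (intro deriv_mono) auto
    moreover have "g 0 + (\<Sum>k<N. u k) - ?E d \<le> g (x N d)" using d optimal by (intro growth) auto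
    moreover have "?E d \<le> ?E b + ?E b'" using d E_nonneg[of b] E_nonneg[of b'] by auto
    ultimately show "(\<Sum>k<N. u k) \<le> g (1/2) - g 0 + (?E b + ?E b')" by linarith
  qed
  then have "u \<longlonglongrightarrow> 0" by (rule summable_LIMSEQ_zero)
  \<comment> \<open>Half the scaled gap: the other half pays for \<open>u k\<close>.\<close>
  define c where "c = \<eta> * (v - Qlim a) / 2"
  have c: "0 < c" using \<eta> suboptimal by (simp add: c_def)
  obtain K where K: "u k < c" if "K \<le> k" for k
    using order_tendstoD(2)[OF \<open>u \<longlonglongrightarrow> 0\<close> c] by (auto simp: eventually_sequentially)
  have drop: "g (x (Suc k) a) \<le> g (x k a) - c" if "K \<le> k" "0 < x (Suc k) a" for k
  proof -
    have "g (x (Suc k) a) = g (x k a) + \<eta> * Qk k a - \<eta> * v + u k"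
      using S.deriv_step_eq[of k a] that by (simp add: u_def)
    also have "\<eta> * Qk k a \<le> \<eta> * Qlim a" using below[of k a] \<eta> by simp
    finally have "g (x (Suc k) a) \<le> g (x k a) + \<eta> * Qlim a - \<eta> * v + u k" by simp
    moreover have "2 * c = \<eta> * v - \<eta> * Qlim a" by (simp add: c_def right_diff_distrib)
    ultimately show ?thesis using K[OF that(1)] by linarith
  qed
  have absorbing: "x (Suc k) a = 0" if "K \<le> k" "x k a = 0" for k
  proof (rule ccontr)
    assume "x (Suc k) a \<noteq> 0"
    then have pos: "0 < x (Suc k) a" using S.x_bounds(1)[of k a] by simp
    then have "g 0 < g (x (Suc k) a)" using S.x_less_1 by (intro deriv_strict_mono) auto
    then show False using drop[OF that(1) pos] that(2) c by simp
  qed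
  obtain T where T: "K \<le> T" "x T a = 0"
  proof (rule ccontr)
    assume "\<not> thesis"
    then have pos: "0 < x k a" if "K \<le> k" for k
      using that S.q_bounds(1)[of k a] \<open>\<And>T. K \<le> T \<Longrightarrow> x T a = 0 \<Longrightarrow> thesis\<close> by force
    have "g (x (K + n) a) \<le> g (x K a) - real n * c" for n
    proof (induction n)
      case (Suc n)
      then show ?case using drop[of "K + n"] pos[of "Suc (K + n)"] by (simp add: algebra_simps)
    qed simp
    moreover obtain n where "g (x K a) - g 0 < real n * c"
      using reals_Archimedean3[OF c] by blast
    ultimately have "g (x (K + n) a) < g 0" by (smt (verit))
    moreover have "g 0 \<le> g (x (K + n) a)"
      using S.q_bounds(1) S.q_less_1 by (intro deriv_mono) auto
    ultimately show False by simp
  qed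
  have "x t a = 0" if "T \<le> t" for t
    using that by (induction t rule: dec_induct) (use T absorbing in auto)
  then show ?thesis by (auto simp: eventually_sequentially)
qed

section \<open>Summable value gaps and finite termination\<close>

locale pmd_run = discounted_mdp P r \<gamma> + scalar_mirror f g
  for P :: "'s::finite \<Rightarrow> 'a::finite \<Rightarrow> 's pmf" and r \<gamma> f g +
  fixes \<eta> :: real and \<pi> :: "nat \<Rightarrow> 's \<Rightarrow> 'a pmf"
  assumes step_size: "0 < \<eta>"
    and step: "mirror_step f g (\<lambda>a. \<eta> * Q (\<pi> k) s a) (pmf (\<pi> k s)) (pmf (\<pi> (Suc k) s))"
begin

interpretation S: mirror_step f g "\<lambda>a. \<eta> * Q (\<pi> k) s a" "pmf (\<pi> k s)" "pmf (\<pi> (Suc k) s)" for k s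
  by (rule step)

lemma sum_scaled: "(\<Sum>a\<in>UNIV. pmf p a * (\<eta> * h a)) = \<eta> * (\<Sum>a\<in>UNIV. pmf p a * h a)"
  by (simp add: sum_distrib_left mult_ac)

lemma one_step_improvement:
  "V (\<pi> k) s \<le> (\<Sum>a\<in>UNIV. pmf (\<pi> (Suc k) s) a * Q (\<pi> k) s a)"
  using S.improvement[of k s] step_size by (simp add: sum_scaled V_eq_average_Q)

lemma V_increasing: "V (\<pi> k) s \<le> V (\<pi> (Suc k)) s"
  using one_step_improvement by (intro V_ge) (simp add: Q_eq_lookahead_V)

lemma one_step_value_le: "(\<Sum>a\<in>UNIV. pmf (\<pi> (Suc k) s) a * Q (\<pi> k) s a) \<le> V (\<pi> (Suc k)) s"
proof -
  have "Q (\<pi> k) s a \<le> Q (\<pi> (Suc k)) s a" for a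
    unfolding Q_eq_lookahead_V by (intro lookahead_mono V_increasing)
  then show ?thesis
    unfolding V_eq_average_Q[of "\<pi> (Suc k)" s] by (intro sum_mono mult_left_mono) auto
qed

lemma Q_gap: "Qs s a - Q (\<pi> k) s a = \<gamma> * (\<Sum>s'\<in>UNIV. pmf (P s a) s' * (Vs s' - V (\<pi> k) s'))"
  by (simp add: Q_opt_eq_lookahead Q_eq_lookahead_V lookahead_diff)

text \<open>
  The partial sums \<open>G n\<close> of the value gaps satisfy \<open>G n s \<le> C + \<gamma> * Max (range (G n))\<close> with \<open>C\<close>
  independent of \<open>n\<close>, because the divergences from the comparator \<open>\<pi>o\<close> telescope. Taking the maximum
  over \<open>s\<close> bounds the partial sums without any estimate of state visitation frequencies.
\<close>

lemma summable_V_gap: "summable (\<lambda>k. Vs s - V (\<pi> k) s)"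
proof -
  obtain \<pi>o where \<pi>o: "V \<pi>o = Vs" "Q \<pi>o = Qs" by (rule optimal_policy_exists)
  define D where "D k s = divergence (pmf (\<pi>o s)) (pmf (\<pi> k s)) / \<eta>" for k s
  have D_nonneg: "0 \<le> D k s" for k s
    unfolding D_def using step_size S.q_simplex S.q_less_1
    by (intro divide_nonneg_pos divergence_nonneg pmf_in_simplex) auto
  define C where "C = Max (range (\<lambda>s. Vs s - V (\<pi> 0) s + D 0 s))"
  have recursion: "Vs s - V (\<pi> (Suc k)) s \<le>
      (\<Sum>a\<in>UNIV. pmf (\<pi>o s) a * (Qs s a - Q (\<pi> k) s a)) + (D k s - D (Suc k) s)" for k s
  proof -
    have "\<eta> * (\<Sum>a\<in>UNIV. pmf (\<pi>o s) a * Q (\<pi> k) s a) + \<eta> * D (Suc k) s \<le>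
        \<eta> * (\<Sum>a\<in>UNIV. pmf (\<pi> (Suc k) s) a * Q (\<pi> k) s a) + \<eta> * D k s"
      using S.three_point[of "pmf (\<pi>o s)" k s] step_size
      by (simp add: D_def sum_scaled pmf_in_simplex)
    then have "(\<Sum>a\<in>UNIV. pmf (\<pi>o s) a * Q (\<pi> k) s a) + D (Suc k) s \<le>
        (\<Sum>a\<in>UNIV. pmf (\<pi> (Suc k) s) a * Q (\<pi> k) s a) + D k s"
      using step_size by (simp flip: distrib_left)
    moreover have "Vs s = (\<Sum>a\<in>UNIV. pmf (\<pi>o s) a * Qs s a)"
      using V_eq_average_Q[of \<pi>o s] \<pi>o by simp
    ultimately show ?thesis
      using one_step_value_le[of k s] by (simp add: right_diff_distrib sum_subtractf)
  qed
  define G where "G n s = (\<Sum>k<n. Vs s - V (\<pi> k) s)" for n s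
  have G_bound: "G n s \<le> C / (1 - \<gamma>)" for n s
  proof -
    define M where "M = Max (range (G n))"
    have M: "G n s \<le> M" for s by (simp add: M_def)
    have "G n s \<le> C + \<gamma> * M" for s
    proof -
      have Q_sum: "(\<Sum>k<n. Qs s a - Q (\<pi> k) s a) \<le> \<gamma> * M" for a
      proof -
        have "(\<Sum>k<n. Qs s a - Q (\<pi> k) s a) = \<gamma> * (\<Sum>s'\<in>UNIV. pmf (P s a) s' * G n s')"
          unfolding Q_gap G_def sum_distrib_left by (rule sum.swap)
        also have "\<dots> \<le> \<gamma> * M" using discount by (intro mult_left_mono average_le M)
        finally show ?thesis .
      qed
      \<comment> \<open>Add one more nonnegative gap and split off the gap at time \<open>0\<close>, so that the remaining
        gaps belong to the updated policies, for which the recursion is available.\<close>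
      have "G n s \<le> G (Suc n) s" using V_le_opt[of "\<pi> n" s] by (simp add: G_def)
      also have "\<dots> = Vs s - V (\<pi> 0) s + (\<Sum>k<n. Vs s - V (\<pi> (Suc k)) s)"
        unfolding G_def by (rule sum.lessThan_Suc_shift)
      also have "(\<Sum>k<n. Vs s - V (\<pi> (Suc k)) s) \<le>
          (\<Sum>k<n. (\<Sum>a\<in>UNIV. pmf (\<pi>o s) a * (Qs s a - Q (\<pi> k) s a)) + (D k s - D (Suc k) s))"
        by (intro sum_mono recursion)
      also have "\<dots> = (\<Sum>a\<in>UNIV. pmf (\<pi>o s) a * (\<Sum>k<n. Qs s a - Q (\<pi> k) s a)) + (D 0 s - D n s)"
        unfolding sum.distrib sum_lessThan_telescope'[of "\<lambda>k. D k s" n]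
          by (subst sum.swap) (simp add: sum_distrib_left)
      also have "\<dots> \<le> \<gamma> * M + D 0 s"
      proof -
        have "(\<Sum>a\<in>UNIV. pmf (\<pi>o s) a * (\<Sum>k<n. Qs s a - Q (\<pi> k) s a)) \<le> \<gamma> * M"
          by (rule average_le) (rule Q_sum)
        with D_nonneg[of n s] show ?thesis by simp
      qed
      finally have "G n s \<le> Vs s - V (\<pi> 0) s + (\<gamma> * M + D 0 s)" by simp
      moreover have "Vs s - V (\<pi> 0) s + D 0 s \<le> C" by (simp add: C_def)
      ultimately show ?thesis by simp
    qed
    then have "M \<le> C + \<gamma> * M" unfolding M_def by (subst Max_le_iff) auto
    then have "M * (1 - \<gamma>) \<le> C" by (simp add: algebra_simps)
    then have "M \<le> C / (1 - \<gamma>)" using discount by (simp add: pos_le_divide_eq)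
    with M[of s] show ?thesis by simp
  qed
  show ?thesis
    using G_bound V_le_opt by (intro summableI_nonneg_bounded[where x = "C / (1 - \<gamma>)"]) (auto simp: G_def)
qed

lemma summable_Q_gap: "summable (\<lambda>k. Qs s a - Q (\<pi> k) s a)"
  unfolding Q_gap by (intro summable_mult summable_sum summable_V_gap)

lemma terminates:
  assumes nonunique: "nonunique_states P r \<gamma> = UNIV"
  shows "\<exists>T. \<forall>t\<ge>T. \<pi> t = \<pi> T \<and> \<pi> T \<in> optimal_policies P r \<gamma>"
proof -
  have "eventually (\<lambda>k. Qs s a < Vs s \<longrightarrow> pmf (\<pi> k s) a = 0) sequentially" for s a
  proof (cases "Qs s a < Vs s")
    case True
    have "s \<in> nonunique_states P r \<gamma>" using nonunique by simp
    then have "\<not> card (optimal_actions P r \<gamma> s) \<le> Suc 0"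
      by (simp add: nonunique_states_def)
    then obtain b b' where b: "b \<noteq> b'" "Qs s b = Vs s" "Qs s b' = Vs s"
      by (auto simp: card_le_Suc0_iff_eq optimal_actions_def)
    have "eventually (\<lambda>k. pmf (\<pi> k s) a = 0) sequentially"
      using suboptimal_action_extinct[OF step step_size Q_le_opt Q_opt_le_V_opt summable_Q_gap b True] .
    then show ?thesis by simp
  qed simp
  then have "eventually (\<lambda>k. \<forall>s a. Qs s a < Vs s \<longrightarrow> pmf (\<pi> k s) a = 0) sequentially"
    by (intro eventually_all_finite)
  then obtain T where T: "pmf (\<pi> t s) a = 0" if "T \<le> t" "Qs s a < Vs s" for t s a
    by (auto simp: eventually_sequentially)
  have greedy: "(\<Sum>a\<in>UNIV. pmf (\<pi> t s) a * Qs s a) = Vs s" if "T \<le> t" for t s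
  proof -
    have "(\<Sum>a\<in>UNIV. pmf (\<pi> t s) a * Qs s a) = (\<Sum>a\<in>UNIV. pmf (\<pi> t s) a * Vs s)"
      using T[OF that, of s] Q_opt_le_V_opt[of s] by (intro sum.cong) (auto simp: less_le)
    then show ?thesis by (simp add: sum_distrib_right[symmetric] sum_pmf_UNIV)
  qed
  have V_opt: "V (\<pi> t) = Vs" if "T \<le> t" for t
  proof (rule ext, rule antisym)
    show "Vs s \<le> V (\<pi> t) s" for s
      by (rule V_ge) (simp add: greedy[OF that] flip: Q_opt_eq_lookahead)
  qed (rule V_le_opt)
  have Q_opt: "Q (\<pi> t) s a = Qs s a" if "T \<le> t" for t s a
    by (simp add: Q_eq_lookahead_V V_opt[OF that] Q_opt_eq_lookahead)
  have stationary: "\<pi> (Suc t) = \<pi> t" if "T \<le> t" for t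
  proof
    fix s
    have "pmf (\<pi> (Suc t) s) = pmf (\<pi> t s)"
      using that by (intro S.no_improvement_imp_fixed) (simp add: sum_scaled Q_opt greedy)
    then show "\<pi> (Suc t) s = \<pi> t s" by (simp add: pmf_eq_iff)
  qed
  have "\<pi> t = \<pi> T" if "T \<le> t" for t
    using that by (induction t rule: dec_induct) (simp_all add: stationary)
  moreover have "\<pi> T \<in> optimal_policies P r \<gamma>"
    using V_opt[of T] by (simp add: optimal_policies_def)
  ultimately show ?thesis by blast
qed

end

theorem theorem3p13:
  fixes P :: "'s::finite \<Rightarrow> 'a::finite \<Rightarrow> 's pmf"
    and r :: "'s \<Rightarrow> 'a \<Rightarrow> real"
    and \<gamma> \<eta> :: real
    and \<psi> :: "real \<Rightarrow> ereal"
    and \<pi> :: "nat \<Rightarrow> 's \<Rightarrow> 'a pmf"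
  assumes reward: "\<And>s a. 0 \<le> r s a \<and> r s a \<le> 1"
    and discount: "0 \<le> \<gamma>" "\<gamma> < 1"
    and nontrivial: "nontrivial_states P r \<gamma> \<noteq> {}"
    and mirror: "mirror_psi \<psi>"
    and step_size: "\<eta> > 0"
    and pmd: "pmd_sequence P r \<gamma> \<psi> \<eta> \<pi>"
    and deriv_0: "psi_deriv_at_0_right \<psi> > -\<infinity>"
    and deriv_1: "psi_deriv_at_1_left \<psi> = \<infinity>"
    and nonunique: "nonunique_states P r \<gamma> = UNIV"
  shows "\<exists>T. \<forall>t\<ge>T. \<pi> t = \<pi> T \<and> \<pi> T \<in> optimal_policies P r \<gamma>"
proof -
  interpret scalar_mirror "\<lambda>x. real_of_ereal (\<psi> x)" "psi_deriv \<psi>"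
    by (rule scalar_mirror_psi[OF mirror deriv_0 deriv_1])
  have "undefined \<in> nonunique_states P r \<gamma>" using nonunique by simp
  then have "1 < card (optimal_actions P r \<gamma> (undefined :: 's))"
    by (simp add: nonunique_states_def)
  also have "\<dots> \<le> card (UNIV :: 'a set)" by (rule card_mono) auto
  finally have actions: "1 < card (UNIV :: 'a set)" .
  interpret pmd_run P r \<gamma> "\<lambda>x. real_of_ereal (\<psi> x)" "psi_deriv \<psi>" \<eta> \<pi>
    using reward discount step_size pmd_mirror_step[OF mirror deriv_0 deriv_1 pmd actions]
    by (intro pmd_run.intro discounted_mdp.intro pmd_run_axioms.intro scalar_mirror_axioms) auto
  show ?thesis by (rule terminates[OF nonunique])
qed

end
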